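(* Let $p$ be fixed and consider the linear model $y_i=\mathbf{x}_i^T\mathbf{b}^*+\epsilon_i$, $i=1,\dots,n$, with $\mathbf{x}_i\in\mathbb{R}^p$, $\mathbf{b}^*\in\mathbb{R}^p$ and $\epsilon_1,\dots,\epsilon_n$ i.i.d. with mean $0$ and variance $\sigma^2$. Let $\mathbf{y}=(y_1,\dots,y_n)^T$, $\mathbf{X}=[\mathbf{x}_1,\dots,\mathbf{x}_n]^T$, and assume $\mathbf{X}^T\mathbf{X}/n\to\mathbf{C}$ for a positive definite matrix $\mathbf{C}$. Let $\mathcal{A}=\{j:b^*_j\neq0\}$, let $\mathbf{C}_{11}$ be the submatrix of $\mathbf{C}$ with rows and columns indexed by $\mathcal{A}$, and $\mathbf{b}^*_1=(b^*_j)_{j\in\mathcal{A}}$. Define \[ \tilde{\mathbf{b}}_n=\arg\min_{\mathbf{b}}\ \|\mathbf{y}-\mathbf{X}\mathbf{b}\|_2^2+\frac{\eta_n}{\alpha_n}\sum_{j=1}^p\Big[\sqrt{1+2\alpha_n|b_j|}-1\Big], \] and let $\tilde{\mathbf{b}}_{n1}=(\tilde b_{nj})_{j\in\mathcal{A}}$, $\tilde{\mathcal{A}}_n=\{j:\tilde b_{nj}\neq0\}$. Suppose $\eta_n/n^{3/4}\to0$, $\eta_n/\sqrt n\to\infty$ and $\alpha_n/\sqrt n\to c_3\in(0,\infty)$. Then (1) $\lim_{n\to\infty}P(\tilde{\mathcal{A}}_n=\mathcal{A})=1$; (2) $\sqrt n(\tilde{\mathbf{b}}_{n1}-\mathbf{b}^*_1)\xrightarrow{d}N(\mathbf{0},\sigma^2\mathbf{C}_{11}^{-1})$.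 *)

theory Defs
  imports "HOL-Probability.Probability"
begin

definition positive_definite :: "real^'p^'p \<Rightarrow> bool" where
  "positive_definite C \<longleftrightarrow> transpose C = C \<and> (\<forall>v. v \<noteq> 0 \<longrightarrow> 0 < v \<bullet> (C *v v))"

definition penalized_obj ::
  "(nat \<Rightarrow> real^'p) \<Rightarrow> (nat \<Rightarrow> real) \<Rightarrow> nat \<Rightarrow> real \<Rightarrow> real \<Rightarrow> real^'p \<Rightarrow> real" where
  "penalized_obj x y n \<eta> \<alpha> b =
     (\<Sum>i<n. (y i - x i \<bullet> b)^2) + \<eta> / \<alpha> * (\<Sum>j\<in>UNIV. sqrt (1 + 2 * \<alpha> * \<bar>b $ j\<bar>) - 1)"

text \<open>A vector indexed by the subset A of coordinates, represented in R^p by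
  zero-padding outside A.\<close>
definition restrict_vec :: "'p set \<Rightarrow> real^'p \<Rightarrow> real^'p" where
  "restrict_vec A v = (\<chi> j. if j \<in> A then v $ j else 0)"

text \<open>The inverse of the submatrix C_11 = (C_jk)_{j,k in A}, zero-padded to a p x p matrix.
  It is computed as the A x A block of the inverse of the block-diagonal matrix diag(C_11, I).\<close>
definition sub_inv_pad :: "real^'p^'p \<Rightarrow> 'p set \<Rightarrow> real^'p^'p" where
  "sub_inv_pad C A =
     (let D = (\<chi> j k. if j \<in> A \<and> k \<in> A then C $ j $ k else if j = k then 1 else 0)
      in (\<chi> j k. if j \<in> A \<and> k \<in> A then matrix_inv D $ j $ k else 0))"

text \<open>Centered (possibly degenerate) multivariate normal law N(0,S) on R^p, defined by its
  characteristic function.\<close>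
definition centered_gaussian :: "(real^'p) measure \<Rightarrow> real^'p^'p \<Rightarrow> bool" where
  "centered_gaussian G S \<longleftrightarrow> prob_space G \<and> sets G = sets borel \<and>
     (\<forall>t. (\<integral>z. cis (t \<bullet> z) \<partial>G) = complex_of_real (exp (- (t \<bullet> (S *v t)) / 2)))"

definition conv_in_distribution ::
  "'a measure \<Rightarrow> (nat \<Rightarrow> 'a \<Rightarrow> 'b::euclidean_space) \<Rightarrow> 'b measure \<Rightarrow> bool" where
  "conv_in_distribution M Z G \<longleftrightarrow> (\<forall>n. Z n \<in> borel_measurable M) \<and>
     (\<forall>f::'b \<Rightarrow> real. continuous_on UNIV f \<and> bounded (range f) \<longrightarrow>
        (\<lambda>n. \<integral>\<omega>. f (Z n \<omega>) \<partial>M) \<longlonglongrightarrow> (\<integral>z. f z \<partial>G))"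

end

theory Submission
  imports Defs
begin

text \<open>
  Put \<open>u = \<surd>n (b - b*)\<close>, \<open>W = n\<^sup>-\<^sup>1\<^sup>/\<^sup>2 \<Sum> \<epsilon>\<^sub>i x\<^sub>i\<close> and \<open>C\<^sub>n = X\<^sup>T X / n\<close>. The objective is, up to a constant,
  \<open>u \<bullet> C\<^sub>n u - 2 W \<bullet> u\<close> plus the penalty. The slope of the penalty at \<open>b*\<^sub>j \<noteq> 0\<close> is of order
  \<open>\<eta>\<^sub>n n\<^sup>-\<^sup>3\<^sup>/\<^sup>4 \<rightarrow> 0\<close> on the scale of \<open>u\<close>, so coercivity of \<open>C\<^sub>n\<close> bounds \<open>|u|\<close> at the minimiser
  by an affine function of \<open>|W|\<close>.
  For \<open>b*\<^sub>j = 0\<close> the penalty of a bounded \<open>u\<^sub>j \<noteq> 0\<close> is at least a multiple of \<open>|u\<^sub>j| \<eta>\<^sub>n / \<surd>n\<close>, which beats the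
  quadratic part, so \<open>u\<^sub>j = 0\<close>. On the remaining coordinates the stationarity equation reads
  \<open>(C\<^sub>n u)\<^sub>j = W\<^sub>j + o(1)\<close>. Hence, uniformly on \<open>{|W| \<le> R}\<close>, the support is correct for large \<open>n\<close> and
  \<open>u - L W \<rightarrow> 0\<close>, where \<open>L\<close> is the padded inverse of \<open>C\<^sub>1\<^sub>1\<close>. These statements are deterministic; the only
  probabilistic inputs are that \<open>W\<close> is tight (bounded second moment) and that its characteristic function
  converges to a Gaussian one. Weak convergence follows by a Levy continuity argument for tight sequences
  in \<open>\<real>\<^sup>p\<close>, based on approximation by trigonometric polynomials.
\<close>

section \<open>Continuity theorem for tight sequences\<close>

text \<open>Expectations of these functions are finite combinations of values of the characteristic
  function, so pointwise convergence of characteristic functions already settles them. Complex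
  coefficients make the class an algebra: a product of two characters is again a character.\<close>

inductive trig_poly :: "('b::euclidean_space \<Rightarrow> complex) \<Rightarrow> bool" where
  cis: "trig_poly (\<lambda>u. c * cis (t \<bullet> u))"
| add: "trig_poly g \<Longrightarrow> trig_poly h \<Longrightarrow> trig_poly (\<lambda>u. g u + h u)"

lemma trig_poly_const: "trig_poly (\<lambda>u. c)"
  using trig_poly.cis[of c 0] by simp

lemma trig_poly_cmult: "trig_poly g \<Longrightarrow> trig_poly (\<lambda>u. c * g u)"
proof (induction rule: trig_poly.induct)
  case (cis d t)
  then show ?case using trig_poly.cis[of "c * d" t] by (simp add: mult.assoc)
next
  case (add g h)
  then show ?case using trig_poly.add by (fastforce simp: distrib_left)
qed

lemma trig_poly_mult:
  assumes "trig_poly g" "trig_poly h" shows "trig_poly (\<lambda>u. g u * h u)"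
  using assms
proof (induction rule: trig_poly.induct)
  case (cis c t)
  from cis show ?case
  proof (induction rule: trig_poly.induct)
    case (cis d s)
    then show ?case using trig_poly.cis[of "c * d" "t + s"]
      by (simp add: inner_add_left cis_mult[symmetric] algebra_simps)
  next
    case (add g h)
    then show ?case using trig_poly.add by (fastforce simp: distrib_left)
  qed
next
  case (add g1 g2)
  then show ?case using trig_poly.add by (fastforce simp: distrib_right)
qed

lemma trig_poly_sum:
  "finite I \<Longrightarrow> (\<And>i. i \<in> I \<Longrightarrow> trig_poly (g i)) \<Longrightarrow> trig_poly (\<lambda>u. \<Sum>i\<in>I. g i u)"
  by (induction rule: finite_induct) (auto intro: trig_poly_const trig_poly.add)

lemma trig_poly_sin: "trig_poly (\<lambda>u. complex_of_real (sin (t \<bullet> u)))"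
proof -
  have "trig_poly (\<lambda>u. (1/(2*\<i>)) * cis (t \<bullet> u) + (-1/(2*\<i>)) * cis ((-t) \<bullet> u))"
    by (intro trig_poly.intros)
  moreover have "(1/(2*\<i>)) * cis (t \<bullet> u) + (-1/(2*\<i>)) * cis ((-t) \<bullet> u) = complex_of_real (sin (t \<bullet> u))" for u
    by (simp add: complex_eq_iff Re_divide Im_divide)
  ultimately show ?thesis by simp
qed

text \<open>Substituting sines for the coordinates turns a polynomial into a trigonometric
  polynomial, since each sine is a combination of two characters and the class is closed under
  products. The factor \<open>k\<close> sets the period.\<close>

lemma trig_poly_polynomial_sin:
  fixes g :: "'b::euclidean_space \<Rightarrow> real"
  assumes "real_polynomial_function g"
  shows "trig_poly (\<lambda>u. complex_of_real (g (\<Sum>b\<in>Basis. sin (k * (u \<bullet> b)) *\<^sub>R b)))"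
  using assms
proof (induction rule: real_polynomial_function.induct)
  case (linear f)
  interpret bounded_linear f by fact
  have "complex_of_real (f (\<Sum>b\<in>Basis. sin (k * (u \<bullet> b)) *\<^sub>R b))
      = (\<Sum>b\<in>Basis. complex_of_real (f b) * complex_of_real (sin ((k *\<^sub>R b) \<bullet> u)))" for u :: 'b
    by (simp add: sum scale inner_commute mult.commute)
  moreover have "trig_poly (\<lambda>u. \<Sum>b\<in>Basis. complex_of_real (f b) * complex_of_real (sin ((k *\<^sub>R b) \<bullet> u)))"
    by (intro trig_poly_sum trig_poly_cmult trig_poly_sin finite_Basis)
  ultimately show ?case by simp
next
  case (const c)
  then show ?case by (rule trig_poly_const)
next
  case (add f g)
  then show ?case using trig_poly.add by fastforce
next
  case (mult f g)
  then show ?case using trig_poly_mult by fastforce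
qed

section \<open>Expectations of trigonometric polynomials and uniform approximation on balls\<close>

lemma (in prob_space) integrable_cis:
  assumes "X \<in> borel_measurable M"
  shows "integrable M (\<lambda>\<omega>. cis (t \<bullet> X \<omega>))"
proof (rule integrable_const_bound[where B = 1])
  have "(\<lambda>z. cis (t \<bullet> z)) \<in> borel_measurable borel"
    by (intro borel_measurable_continuous_onI continuous_intros)
  from measurable_compose[OF assms this] show "(\<lambda>\<omega>. cis (t \<bullet> X \<omega>)) \<in> borel_measurable M" .
qed simp

lemma (in prob_space) trig_poly_integrable:
  "trig_poly g \<Longrightarrow> X \<in> borel_measurable M \<Longrightarrow> integrable M (\<lambda>\<omega>. g (X \<omega>))"
  by (induction rule: trig_poly.induct) (auto intro: integrable_cis)

lemma trig_poly_expectation_tendsto: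
  fixes Z :: "nat \<Rightarrow> 'a \<Rightarrow> 'b::euclidean_space"
  assumes "prob_space M" "prob_space G" "sets G = sets borel" "\<And>n. Z n \<in> borel_measurable M"
    and cf: "\<And>t. (\<lambda>n. \<integral>\<omega>. cis (t \<bullet> Z n \<omega>) \<partial>M) \<longlonglongrightarrow> (\<integral>z. cis (t \<bullet> z) \<partial>G)"
    and "trig_poly g"
  shows "(\<lambda>n. \<integral>\<omega>. g (Z n \<omega>) \<partial>M) \<longlonglongrightarrow> (\<integral>z. g z \<partial>G)"
  using \<open>trig_poly g\<close>
proof (induction rule: trig_poly.induct)
  case (cis c t)
  show ?case by (simp add: tendsto_mult_left cf)
next
  case (add g h)
  interpret M: prob_space M by fact
  interpret G: prob_space G by fact
  have "(\<lambda>z. z) \<in> borel_measurable G" using assms(3) by (simp add: measurable_ident_sets)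
  then show ?case
    using add assms(4) tendsto_add[OF add.IH]
    by (simp add: M.trig_poly_integrable G.trig_poly_integrable[of _ "\<lambda>z. z"])
qed

text \<open>The approximation is good only on a ball, but its error is bounded everywhere, so mass
  outside the ball costs at most \<open>B\<close> times its probability. It serves both for the
  sequence and for the limit law.\<close>

lemma (in prob_space) expectation_diff_le_off_ball:
  fixes X :: "'a \<Rightarrow> 'b::euclidean_space" and f T :: "'b \<Rightarrow> real"
  assumes [measurable]: "X \<in> borel_measurable M"
    and "integrable M (\<lambda>\<omega>. f (X \<omega>))" "integrable M (\<lambda>\<omega>. T (X \<omega>))"
    and near: "\<And>u. norm u \<le> R \<Longrightarrow> \<bar>f u - T u\<bar> \<le> e"
    and far: "\<And>u. \<bar>f u - T u\<bar> \<le> e + B"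
  shows "\<bar>(\<integral>\<omega>. f (X \<omega>) \<partial>M) - (\<integral>\<omega>. T (X \<omega>) \<partial>M)\<bar> \<le> e + B * prob {\<omega> \<in> space M. norm (X \<omega>) > R}"
proof -
  let ?E = "{\<omega> \<in> space M. norm (X \<omega>) > R}"
  have E[measurable]: "?E \<in> events" by measurable
  have "\<bar>(\<integral>\<omega>. f (X \<omega>) \<partial>M) - (\<integral>\<omega>. T (X \<omega>) \<partial>M)\<bar> = \<bar>\<integral>\<omega>. f (X \<omega>) - T (X \<omega>) \<partial>M\<bar>"
    using assms by simp
  also have "\<dots> \<le> (\<integral>\<omega>. \<bar>f (X \<omega>) - T (X \<omega>)\<bar> \<partial>M)"
    by (rule integral_abs_bound)
  also have "\<dots> \<le> (\<integral>\<omega>. e + B * indicator ?E \<omega> \<partial>M)"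
  proof (rule integral_mono)
    show "\<bar>f (X \<omega>) - T (X \<omega>)\<bar> \<le> e + B * indicator ?E \<omega>" if "\<omega> \<in> space M" for \<omega>
      using near[of "X \<omega>"] far[of "X \<omega>"] that by (auto simp: indicator_def)
  qed (use assms in \<open>auto intro!: integrable_real_indicator simp: emeasure_eq_measure\<close>)
  also have "\<dots> = e + B * prob ?E"
    by (subst Bochner_Integration.integral_add)
      (auto intro!: integrable_real_indicator simp: emeasure_eq_measure prob_space)
  finally show ?thesis .
qed

text \<open>Pull \<open>f\<close> back to the cube by arcsines, approximate there by a polynomial
  \<open>g\<close>, and return through \<open>S\<close>, the coordinatewise sine. On the ball the
  arcsine undoes the sine, so the error is that of \<open>g\<close>. Since \<open>S u\<close> lies
  in the cube for every \<open>u\<close>, the value \<open>g (S u)\<close> is within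
  \<open>e\<close> of some value of \<open>f\<close> everywhere; this yields the global bound
  \<open>e + 2 * B\<close>.\<close>

lemma trig_approximation:
  fixes f :: "'b::euclidean_space \<Rightarrow> real"
  assumes cont: "continuous_on UNIV f" and bd: "\<And>u. \<bar>f u\<bar> \<le> B" and "0 < R" "0 < e"
  obtains T where "trig_poly (\<lambda>u. complex_of_real (T u))"
    "\<And>u. norm u \<le> R \<Longrightarrow> \<bar>f u - T u\<bar> \<le> e" "\<And>u. \<bar>f u - T u\<bar> \<le> e + 2 * B"
proof -
  \<comment> \<open>For \<open>norm u \<le> R\<close> this keeps \<open>k * (u \<bullet> b)\<close>
    within [-pi/2, pi/2], the range where \<open>arcsin\<close> inverts \<open>sin\<close>.\<close>
  define k where "k = pi / (2 * R)"
  have "k > 0" using \<open>0 < R\<close> by (simp add: k_def)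
  define h :: "'b \<Rightarrow> 'b" where "h s = (\<Sum>b\<in>Basis. (arcsin (s \<bullet> b) / k) *\<^sub>R b)" for s
  define S where "S u = (\<Sum>b\<in>Basis. sin (k * (u \<bullet> b)) *\<^sub>R b)" for u :: 'b
  have Sb: "S u \<bullet> b = sin (k * (u \<bullet> b))" if "b \<in> Basis" for u b
    using that by (simp add: S_def inner_sum_left_Basis)
  have Scube: "S u \<in> cbox (-One) One" for u
    by (simp add: mem_box Sb)
  have "continuous_on (cbox (-One) One) h"
    unfolding h_def using \<open>k > 0\<close>
    by (intro continuous_intros) (auto simp: mem_box)
  then have "continuous_on (cbox (-One) One) (\<lambda>s. f (h s))"
    by (rule continuous_on_compose2[OF cont]) simp
  from Stone_Weierstrass_real_polynomial_function[OF compact_cbox this \<open>0 < e\<close>]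
  obtain g where g: "real_polynomial_function g" "\<And>s. s \<in> cbox (-One) One \<Longrightarrow> \<bar>f (h s) - g s\<bar> < e"
    by blast
  show ?thesis
  proof (rule that[of "\<lambda>u. g (S u)"])
    show "trig_poly (\<lambda>u. complex_of_real (g (S u)))"
      unfolding S_def by (rule trig_poly_polynomial_sin) fact
    have T: "\<bar>f (h (S u)) - g (S u)\<bar> < e" for u
      using g(2) Scube by blast
    show "\<bar>f u - g (S u)\<bar> \<le> e" if "norm u \<le> R" for u
    proof -
      have "h (S u) = (\<Sum>b\<in>Basis. (u \<bullet> b) *\<^sub>R b)"
        unfolding h_def
      proof (rule sum.cong[OF refl])
        fix b :: 'b assume b: "b \<in> Basis"
        have "\<bar>u \<bullet> b\<bar> \<le> R" using Basis_le_norm[OF b, of u] that by simp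
        then have "\<bar>k * (u \<bullet> b)\<bar> \<le> pi / 2"
          using \<open>0 < R\<close> by (simp add: k_def abs_mult field_simps)
        then have "arcsin (sin (k * (u \<bullet> b))) = k * (u \<bullet> b)"
          by (intro arcsin_sin) auto
        then show "(arcsin (S u \<bullet> b) / k) *\<^sub>R b = (u \<bullet> b) *\<^sub>R b"
          using b \<open>k > 0\<close> by (simp add: Sb)
      qed
      then have "h (S u) = u" by (simp add: euclidean_representation)
      with T[of u] show ?thesis by simp
    qed
    show "\<bar>f u - g (S u)\<bar> \<le> e + 2 * B" for u
      using T[of u] bd[of u] bd[of "h (S u)"] by linarith
  qed
qed

text \<open>Replace the bounded continuous test function by a trigonometric polynomial that is close
  on a large ball. Tightness makes the mass outside that ball uniformly small, and the
  characteristic functions handle the polynomial.\<close>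

lemma levy_continuity_tight:
  fixes Z :: "nat \<Rightarrow> 'a \<Rightarrow> 'b::euclidean_space"
  assumes "prob_space M" "prob_space G" "sets G = sets borel" and Z: "\<And>n. Z n \<in> borel_measurable M"
    and cf: "\<And>t. (\<lambda>n. \<integral>\<omega>. cis (t \<bullet> Z n \<omega>) \<partial>M) \<longlonglongrightarrow> (\<integral>z. cis (t \<bullet> z) \<partial>G)"
    and tight: "\<And>e. e > 0 \<Longrightarrow> \<exists>R. \<forall>\<^sub>F n in sequentially. measure M {\<omega> \<in> space M. norm (Z n \<omega>) > R} \<le> e"
  shows "conv_in_distribution M Z G"
  unfolding conv_in_distribution_def
proof (intro conjI allI impI)
  fix f :: "'b \<Rightarrow> real"
  assume f: "continuous_on UNIV f \<and> bounded (range f)"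
  interpret M: prob_space M by fact
  interpret G: prob_space G by fact
  have idG[measurable]: "(\<lambda>z. z) \<in> borel_measurable G"
    using assms(3) by (simp add: measurable_ident_sets)
  obtain B where B: "\<And>u. \<bar>f u\<bar> \<le> B"
    using f unfolding bounded_iff by auto
  then have "B \<ge> 0" by (meson abs_ge_zero order_trans)
  have fborel: "f \<in> borel_measurable borel"
    using f by (intro borel_measurable_continuous_onI) auto
  have fM: "integrable M (\<lambda>\<omega>. f (Z n \<omega>))" for n
    using B measurable_compose[OF Z fborel] by (intro M.integrable_const_bound[where B = B]) auto
  have fG: "integrable G (\<lambda>z. f z)"
    using B measurable_compose[OF idG fborel] by (intro G.integrable_const_bound[where B = B]) auto
  show "(\<lambda>n. \<integral>\<omega>. f (Z n \<omega>) \<partial>M) \<longlonglongrightarrow> (\<integral>z. f z \<partial>G)"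
  proof (rule tendstoI)
    fix \<delta> :: real assume "\<delta> > 0"
    \<comment> \<open>The error budget: \<open>e + 2 * B * e\<close> under the law of
      \<open>Z n\<close>, the same under \<open>G\<close>, and \<open>e\<close> for the convergence
      of the polynomial's expectation. The total \<open>(3 + 4 * B) * e\<close> is half of
      \<open>\<delta>\<close>.\<close>
    define e where "e = \<delta> / (2 * (3 + 4 * B))"
    have "e > 0" using \<open>\<delta> > 0\<close> \<open>B \<ge> 0\<close> by (simp add: e_def)
    define D where "D = 3 + 4 * B"
    have "D > 0" using \<open>B \<ge> 0\<close> by (simp add: D_def)
    then have "D * e = \<delta> / 2" by (simp add: e_def flip: D_def)
    then have le\<delta>: "3 * e + 4 * B * e < \<delta>"
      using \<open>\<delta> > 0\<close> by (simp add: D_def distrib_right)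
    obtain R1 where R1: "\<forall>\<^sub>F n in sequentially. M.prob {\<omega> \<in> space M. norm (Z n \<omega>) > R1} \<le> e"
      using tight[OF \<open>e > 0\<close>] by blast
    \<comment> \<open>A single probability law on a Euclidean space is tight: the tail events
      decrease to the empty set.\<close>
    obtain R2 :: nat where R2: "G.prob {z \<in> space G. norm z > real R2} \<le> e"
    proof -
      have "(\<lambda>m. G.prob {z \<in> space G. norm z > real m}) \<longlonglongrightarrow> G.prob (\<Inter>m. {z \<in> space G. norm z > real m})"
        by (intro G.finite_Lim_measure_decseq) (auto simp: decseq_def)
      also have "(\<Inter>m. {z \<in> space G. norm z > real m}) = {}"
        using real_arch_simple by (auto simp: set_eq_iff not_less)
      finally have "(\<lambda>m. G.prob {z \<in> space G. norm z > real m}) \<longlonglongrightarrow> 0" by simp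
      from order_tendstoD(2)[OF this \<open>e > 0\<close>] show ?thesis
        using that unfolding eventually_sequentially by (meson less_imp_le order_refl)
    qed
    define R where "R = max 1 (max R1 (real R2))"
    have "R > 0" by (simp add: R_def)
    obtain T where T: "trig_poly (\<lambda>u. complex_of_real (T u))"
      "\<And>u. norm u \<le> R \<Longrightarrow> \<bar>f u - T u\<bar> \<le> e" "\<And>u. \<bar>f u - T u\<bar> \<le> e + 2 * B"
      using trig_approximation[OF conjunct1[OF f] B \<open>R > 0\<close> \<open>e > 0\<close>] by blast
    have TM: "integrable M (\<lambda>\<omega>. T (Z n \<omega>))" for n
      using M.trig_poly_integrable[OF T(1) Z[of n]] by (simp only: complex_of_real_integrable_eq)
    have TG: "integrable G (\<lambda>z. T z)"
      using G.trig_poly_integrable[OF T(1) idG] by (simp only: complex_of_real_integrable_eq)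
    have "(\<lambda>n. complex_of_real (\<integral>\<omega>. T (Z n \<omega>) \<partial>M)) \<longlonglongrightarrow> complex_of_real (\<integral>z. T z \<partial>G)"
      using trig_poly_expectation_tendsto[OF assms(1-4) cf T(1)] by simp
    then have "(\<lambda>n. \<integral>\<omega>. T (Z n \<omega>) \<partial>M) \<longlonglongrightarrow> (\<integral>z. T z \<partial>G)"
      by (simp only: tendsto_of_real_iff)
    from tendstoD[OF this \<open>e > 0\<close>]
    have ev: "\<forall>\<^sub>F n in sequentially. \<bar>(\<integral>\<omega>. T (Z n \<omega>) \<partial>M) - (\<integral>z. T z \<partial>G)\<bar> < e"
      by (simp add: dist_real_def)
    have "G.prob {z \<in> space G. norm z > R} \<le> G.prob {z \<in> space G. norm z > real R2}"
      by (intro G.finite_measure_mono) (auto simp: R_def)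
    then have PG: "2 * B * G.prob {z \<in> space G. norm z > R} \<le> 2 * B * e"
      using R2 \<open>B \<ge> 0\<close> by (intro mult_left_mono) auto
    from ev R1 show "\<forall>\<^sub>F n in sequentially. dist (\<integral>\<omega>. f (Z n \<omega>) \<partial>M) (\<integral>z. f z \<partial>G) < \<delta>"
    proof eventually_elim
      case (elim n)
      have [measurable]: "Z n \<in> borel_measurable M" by (rule Z)
      have "M.prob {\<omega> \<in> space M. norm (Z n \<omega>) > R} \<le> M.prob {\<omega> \<in> space M. norm (Z n \<omega>) > R1}"
        by (intro M.finite_measure_mono) (auto simp: R_def)
      then have PM: "2 * B * M.prob {\<omega> \<in> space M. norm (Z n \<omega>) > R} \<le> 2 * B * e"
        using elim(2) \<open>B \<ge> 0\<close> by (intro mult_left_mono) auto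
      show ?case
        using M.expectation_diff_le_off_ball[where R = R, OF Z fM TM T(2,3), of n]
          G.expectation_diff_le_off_ball[where R = R, OF idG fG TG T(2,3)] PM PG elim(1) le\<delta>
        unfolding dist_real_def by linarith
    qed
  qed
qed (fact Z)

section \<open>Existence of Gaussian laws\<close>

lemma psd_cauchy_schwarz:
  fixes B :: "'b::real_vector \<Rightarrow> 'b \<Rightarrow> real"
  assumes B: "bilinear B" and sym: "\<And>u v. B u v = B v u" and psd: "\<And>v. 0 \<le> B v v"
  shows "(B c t)\<^sup>2 \<le> B c c * B t t"
proof -
  have q: "0 \<le> B t t + 2 * x * B c t + x\<^sup>2 * B c c" for x
    using psd[of "t + x *\<^sub>R c"]
    by (simp add: bilinear_ladd[OF B] bilinear_radd[OF B] bilinear_lmul[OF B] bilinear_rmul[OF B]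
        sym[of t c] algebra_simps power2_eq_square)
  show ?thesis
  proof (cases "B c c = 0")
    case True
    have "B c t = 0"
    proof (rule ccontr)
      assume ne: "B c t \<noteq> 0"
      \<comment> \<open>With \<open>B c c = 0\<close> the quadratic in \<open>x\<close> is affine,
        and this \<open>x\<close> gives it the value -1.\<close>
      from q[of "- (B t t + 1) / (2 * B c t)"] show False using True ne by (simp add: field_simps)
    qed
    then show ?thesis using True by simp
  next
    case False
    then have "B c c > 0" using psd[of c] by simp
    \<comment> \<open>This is the minimiser of the quadratic in \<open>x\<close>.\<close>
    with q[of "- B c t / B c c"] show ?thesis
      by (simp add: field_simps power2_eq_square)
  qed
qed

text \<open>Completing squares, as in a Cholesky factorisation: subtracting one square moves the
  basis vector \<open>c\<close> into the kernel and keeps the form positive semidefinite. The set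
  \<open>J\<close> holds the basis vectors not yet known to lie in the kernel.\<close>

lemma psd_sum_of_squares:
  fixes B :: "'b::euclidean_space \<Rightarrow> 'b \<Rightarrow> real"
  assumes "finite J" "bilinear B" "\<And>u v. B u v = B v u" "\<And>v. 0 \<le> B v v"
    and "\<And>b v. b \<in> Basis - J \<Longrightarrow> B b v = 0"
  shows "\<exists>w. \<forall>t. B t t = (\<Sum>b\<in>J. (t \<bullet> w b)\<^sup>2)"
  using assms
proof (induction J arbitrary: B rule: finite_induct)
  case empty
  have "B t t = 0" for t
  proof -
    have lin: "linear (\<lambda>u. B u t)" using empty.prems(1) by (simp add: bilinear_def)
    have "B t t = (\<Sum>b\<in>Basis. (t \<bullet> b) * B b t)"
      using linear_sum[OF lin, of "\<lambda>b. (t \<bullet> b) *\<^sub>R b" Basis]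
      by (simp add: euclidean_representation bilinear_lmul[OF empty.prems(1)])
    then show ?thesis using empty.prems(4) by simp
  qed
  then show ?case by simp
next
  case (insert c J)
  note B = insert.prems(1) and sym = insert.prems(2) and psd = insert.prems(3)
  note Bs = bilinear_ladd[OF B] bilinear_radd[OF B] bilinear_lmul[OF B] bilinear_rmul[OF B]
  note CS = psd_cauchy_schwarz[OF B sym psd]
  define a where "a = B c c"
  have "a \<ge> 0" using psd by (simp add: a_def)
  \<comment> \<open>If \<open>a = 0\<close>, division by zero returns 0 and \<open>B'\<close> is
    \<open>B\<close>; Cauchy-Schwarz then shows that \<open>c\<close> is already in the
    kernel.\<close>
  define B' where "B' u v = B u v - B c u * B c v / a" for u v
  have "bilinear B'"
    unfolding bilinear_def B'_def by (auto intro!: linearI simp: Bs algebra_simps add_divide_distrib)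
  moreover have "B' u v = B' v u" for u v by (simp add: B'_def sym mult.commute)
  moreover have "0 \<le> B' v v" for v
    using CS[of c v] \<open>a \<ge> 0\<close> psd[of v] unfolding B'_def a_def[symmetric]
    by (cases "a = 0") (auto simp: field_simps power2_eq_square)
  moreover have "B' b v = 0" if b: "b \<in> Basis - J" for b v
  proof (cases "b = c")
    case True
    show ?thesis
    proof (cases "a = 0")
      case True
      then have "B c v = 0" using CS[of c v] by (simp add: a_def)
      with \<open>b = c\<close> True show ?thesis by (simp add: B'_def)
    next
      case False
      with \<open>b = c\<close> show ?thesis by (simp add: B'_def a_def)
    qed
  next
    case False
    then show ?thesis using insert.prems(4) b sym[of c b] by (simp add: B'_def)
  qed
  ultimately obtain w where w: "\<And>t. B' t t = (\<Sum>b\<in>J. (t \<bullet> w b)\<^sup>2)"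
    using insert.IH[of B'] by blast
  \<comment> \<open>The vector representing the linear form \<open>B c\<close> divided by
    \<open>sqrt a\<close>; it is the zero vector if \<open>a = 0\<close>, in agreement with the
    convention for \<open>B'\<close>.\<close>
  define wc where "wc = (\<Sum>b\<in>Basis. (B c b / sqrt a) *\<^sub>R b)"
  have lin: "linear (B c)" using B by (simp add: bilinear_def)
  have wc: "t \<bullet> wc = B c t / sqrt a" for t
  proof -
    have "B c t = (\<Sum>b\<in>Basis. (t \<bullet> b) * B c b)"
      using linear_sum[OF lin, of "\<lambda>b. (t \<bullet> b) *\<^sub>R b" Basis] Bs
      by (simp add: euclidean_representation)
    then show ?thesis
      by (simp add: wc_def inner_sum_right sum_divide_distrib mult.commute)
  qed
  have "B t t = (\<Sum>b\<in>insert c J. (t \<bullet> (w(c := wc)) b)\<^sup>2)" for t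
  proof -
    have "(\<Sum>b\<in>J. (t \<bullet> (w(c := wc)) b)\<^sup>2) = B' t t"
      unfolding w using insert.hyps by (intro sum.cong) auto
    moreover have "(t \<bullet> wc)\<^sup>2 = B c t * B c t / a"
      using \<open>a \<ge> 0\<close> by (simp add: wc power_divide power2_eq_square)
    ultimately show ?thesis using insert.hyps by (simp add: B'_def)
  qed
  then show ?case by blast
qed

text \<open>The law is the image of independent standard normal coordinates under \<open>X\<close>,
  whose covariance form is the sum of the squares \<open>(t \<bullet> w b)\<^sup>2\<close>.
  Semidefiniteness is the right generality because the noise variance may be 0.\<close>

lemma centered_gaussian_exists:
  fixes S :: "real^'p^'p"
  assumes sym: "transpose S = S" and psd: "\<And>v. 0 \<le> v \<bullet> (S *v v)"
  shows "\<exists>G. centered_gaussian G S"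
proof -
  have bil: "bilinear (\<lambda>u v. u \<bullet> (S *v v))"
    unfolding bilinear_def
    by (auto intro!: linearI simp: inner_add_left inner_add_right matrix_vector_right_distrib
        matrix_vector_mult_scaleR)
  have "u \<bullet> (S *v v) = v \<bullet> (S *v u)" for u v
    by (metis dot_lmul_matrix inner_commute sym vector_transpose_matrix)
  with psd_sum_of_squares[of Basis, OF finite_Basis bil _ psd]
  obtain w :: "real^'p \<Rightarrow> real^'p" where w: "\<And>t. t \<bullet> (S *v t) = (\<Sum>b\<in>Basis. (t \<bullet> w b)\<^sup>2)"
    by auto
  interpret N: real_distribution std_normal_distribution by (rule real_dist_normal_dist)
  let ?P = "Pi\<^sub>M (Basis :: (real^'p) set) (\<lambda>_. std_normal_distribution)"
  interpret P: finite_product_prob_space "\<lambda>_. std_normal_distribution" "Basis :: (real^'p) set"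
    by standard auto
  define X where "X g = (\<Sum>b\<in>Basis. g b *\<^sub>R w b)" for g :: "real^'p \<Rightarrow> real"
  have X[measurable]: "X \<in> borel_measurable ?P"
    unfolding X_def by measurable
  define G where "G = distr ?P borel X"
  have "prob_space G" unfolding G_def by (rule P.prob_space_distr) (rule X)
  moreover have "(\<integral>z. cis (t \<bullet> z) \<partial>G) = complex_of_real (exp (- (t \<bullet> (S *v t)) / 2))" for t
  proof -
    have cm: "(\<lambda>z. cis (t \<bullet> z)) \<in> borel_measurable borel"
      by (intro borel_measurable_continuous_onI continuous_intros)
    have cis_sum: "cis (\<Sum>b\<in>I. h b) = (\<Prod>b\<in>I. cis (h b))" if "finite I" for h and I :: "(real^'p) set"
      using that by (induction rule: finite_induct) (auto simp flip: cis_mult)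
    have "(\<integral>z. cis (t \<bullet> z) \<partial>G) = (\<integral>g. cis (t \<bullet> X g) \<partial>?P)"
      unfolding G_def by (rule integral_distr[OF X cm])
    also have "\<dots> = (\<integral>g. (\<Prod>b\<in>Basis. cis ((t \<bullet> w b) * g b)) \<partial>?P)"
      by (simp add: X_def inner_sum_right cis_sum mult.commute)
    also have "\<dots> = (\<Prod>b\<in>Basis. \<integral>s. cis ((t \<bullet> w b) * s) \<partial>std_normal_distribution)"
      by (rule P.product_integral_prod) (auto intro!: N.integrable_iexp simp: cis_conv_exp)
    also have "\<dots> = (\<Prod>b\<in>Basis. char std_normal_distribution (t \<bullet> w b))"
      by (simp add: char_def cis_conv_exp)
    also have "\<dots> = complex_of_real (exp (- (t \<bullet> (S *v t)) / 2))"
      unfolding w char_std_normal_distribution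
      by (simp add: exp_sum[symmetric] sum_negf sum_divide_distrib flip: of_real_prod exp_sum)
    finally show ?thesis .
  qed
  ultimately show ?thesis
    unfolding centered_gaussian_def G_def by auto
qed

section \<open>Characteristic functions of weighted sums\<close>

lemma abs_exp_minus_linear_le:
  fixes s :: real assumes "s \<ge> 0" shows "\<bar>exp (- s) - (1 - s)\<bar> \<le> s\<^sup>2"
proof -
  have "1 - s \<le> exp (- s)" using exp_ge_add_one_self[of "- s"] by simp
  moreover have "exp (- s) \<le> 1 / (1 + s)"
    using exp_ge_add_one_self[of s] assms by (simp add: exp_minus field_simps)
  moreover have "1 / (1 + s) \<le> 1 - s + s\<^sup>2"
    using assms by (simp add: divide_le_eq) (simp add: power2_eq_square algebra_simps)
  ultimately show ?thesis by linarith
qed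

text \<open>Both functions have the expansion \<open>1 - \<sigma>\<^sup>2 * a\<^sup>2 / 2\<close> up
  to \<open>o(a\<^sup>2)\<close>. A second moment suffices for this because the Taylor remainder
  involves the truncated third moment \<open>h\<close>, which vanishes at 0 by dominated
  convergence.\<close>

lemma (in prob_space) char_approx_gaussian:
  assumes X[measurable]: "random_variable borel X"
    and int: "integrable M X" "integrable M (\<lambda>\<omega>. (X \<omega>)\<^sup>2)"
    and mean: "expectation X = 0" and var: "variance X = \<sigma>\<^sup>2" and "e > 0"
  shows "\<exists>\<delta>>0. \<forall>a. \<bar>a\<bar> < \<delta> \<longrightarrow>
    cmod (char (distr M borel X) a - complex_of_real (exp (- (\<sigma>\<^sup>2 * a\<^sup>2 / 2)))) \<le> e * a\<^sup>2"
proof -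
  define h where "h a = expectation (\<lambda>\<omega>. min (6 * (X \<omega>)\<^sup>2) (\<bar>a\<bar> * \<bar>X \<omega>\<bar> ^ 3))" for a
  have hint: "integrable M (\<lambda>\<omega>. min (6 * (X \<omega>)\<^sup>2) (\<bar>a\<bar> * \<bar>X \<omega>\<bar> ^ 3))" for a
    by (rule Bochner_Integration.integrable_bound[of _ "\<lambda>\<omega>. 6 * (X \<omega>)\<^sup>2"]) (use int in auto)
  have "(\<lambda>n. h (inverse (real (Suc n)))) \<longlonglongrightarrow> expectation (\<lambda>\<omega>. 0)"
    unfolding h_def
  proof (rule integral_dominated_convergence[where w = "\<lambda>\<omega>. 6 * (X \<omega>)\<^sup>2"])
    have "(\<lambda>n. min (6 * y\<^sup>2) (\<bar>inverse (real (Suc n))\<bar> * \<bar>y\<bar> ^ 3)) \<longlonglongrightarrow> min (6 * y\<^sup>2) (\<bar>0\<bar> * \<bar>y\<bar> ^ 3)" for y :: real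
      by (intro tendsto_intros LIMSEQ_inverse_real_of_nat)
    then show "AE \<omega> in M. (\<lambda>n. min (6 * (X \<omega>)\<^sup>2) (\<bar>inverse (real (Suc n))\<bar> * \<bar>X \<omega>\<bar> ^ 3)) \<longlonglongrightarrow> 0"
      by simp
  qed (use int in auto)
  then have "(\<lambda>n. h (inverse (real (Suc n)))) \<longlonglongrightarrow> 0" by simp
  from order_tendstoD(2)[OF this \<open>e > 0\<close>] obtain m where m: "h (inverse (real (Suc m))) < e"
    unfolding eventually_sequentially by blast
  have "((\<lambda>a. (\<sigma>\<^sup>2 / 2)\<^sup>2 * a\<^sup>2) \<longlongrightarrow> (\<sigma>\<^sup>2 / 2)\<^sup>2 * 0\<^sup>2) (nhds 0)"
    by (intro tendsto_intros filterlim_ident)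
  then have "\<forall>\<^sub>F a in nhds 0. (\<sigma>\<^sup>2 / 2)\<^sup>2 * a\<^sup>2 < e / 2"
    using \<open>e > 0\<close> by (intro order_tendstoD(2)) auto
  then obtain \<delta>2 where d2: "\<delta>2 > 0" "\<And>a. \<bar>a\<bar> < \<delta>2 \<Longrightarrow> (\<sigma>\<^sup>2 / 2)\<^sup>2 * a\<^sup>2 < e / 2"
    unfolding eventually_nhds_metric by (auto simp: dist_real_def)
  show ?thesis
  proof (intro exI conjI allI impI)
    show "0 < min \<delta>2 (inverse (real (Suc m)))" using d2 by simp
    fix a assume a: "\<bar>a\<bar> < min \<delta>2 (inverse (real (Suc m)))"
    define s where "s = \<sigma>\<^sup>2 * a\<^sup>2 / 2"
    \<comment> \<open>\<open>h\<close> increases with the absolute value of its argument, so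
      smallness at one point of the sequence covers every smaller \<open>a\<close>.\<close>
    have "h a \<le> h (inverse (real (Suc m)))"
      unfolding h_def
    proof (rule integral_mono[OF hint hint])
      fix \<omega>
      have "\<bar>a\<bar> * \<bar>X \<omega>\<bar> ^ 3 \<le> \<bar>inverse (real (Suc m))\<bar> * \<bar>X \<omega>\<bar> ^ 3"
        using a by (intro mult_right_mono) auto
      then show "min (6 * (X \<omega>)\<^sup>2) (\<bar>a\<bar> * \<bar>X \<omega>\<bar> ^ 3) \<le> min (6 * (X \<omega>)\<^sup>2) (\<bar>inverse (real (Suc m))\<bar> * \<bar>X \<omega>\<bar> ^ 3)"
        by linarith
    qed
    then have "a\<^sup>2 / 6 * h a \<le> a\<^sup>2 / 6 * e" using m by (intro mult_left_mono) auto
    also have "\<dots> \<le> e / 2 * a\<^sup>2" using \<open>e > 0\<close> by (simp add: field_simps)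
    finally have 1: "cmod (char (distr M borel X) a - (1 - a\<^sup>2 * \<sigma>\<^sup>2 / 2)) \<le> e / 2 * a\<^sup>2"
      using char_approx3'[OF X int mean var refl, of a] by (simp add: h_def)
    have "s \<ge> 0" by (simp add: s_def)
    have "s\<^sup>2 = ((\<sigma>\<^sup>2 / 2)\<^sup>2 * a\<^sup>2) * a\<^sup>2" by (simp add: s_def power2_eq_square field_simps)
    also have "\<dots> \<le> e / 2 * a\<^sup>2" using d2(2)[of a] a by (intro mult_right_mono) auto
    finally have "\<bar>exp (- s) - (1 - s)\<bar> \<le> e / 2 * a\<^sup>2"
      using abs_exp_minus_linear_le[OF \<open>s \<ge> 0\<close>] by linarith
    moreover have "cmod ((1 - a\<^sup>2 * \<sigma>\<^sup>2 / 2) - complex_of_real (exp (- s))) = \<bar>exp (- s) - (1 - s)\<bar>"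
    proof -
      have "(1 - a\<^sup>2 * \<sigma>\<^sup>2 / 2) - complex_of_real (exp (- s)) = complex_of_real ((1 - s) - exp (- s))"
        by (simp add: s_def mult.commute)
      then show ?thesis by (simp only: norm_of_real abs_minus_commute)
    qed
    ultimately show "cmod (char (distr M borel X) a - complex_of_real (exp (- (\<sigma>\<^sup>2 * a\<^sup>2 / 2)))) \<le> e * a\<^sup>2"
      using 1 norm_triangle_ineq[of "char (distr M borel X) a - (1 - a\<^sup>2 * \<sigma>\<^sup>2 / 2)"
          "(1 - a\<^sup>2 * \<sigma>\<^sup>2 / 2) - complex_of_real (exp (- s))"]
      by (simp add: s_def)
  qed
qed

text \<open>By independence the characteristic function is a product of
  \<open>\<phi> (a n i)\<close>. All factors lie in the unit disc, so replacing each by its Gaussian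
  counterpart costs at most the sum of the individual errors, hence at most \<open>e\<close> times
  the sum of squared weights. Uniform smallness of the weights, in the role of a Lindeberg
  condition, makes the local expansion apply to all factors at once.\<close>

lemma (in prob_space) clt_weighted_sum_char:
  fixes \<epsilon> :: "nat \<Rightarrow> 'a \<Rightarrow> real" and a :: "nat \<Rightarrow> nat \<Rightarrow> real"
  assumes indep: "indep_vars (\<lambda>_. borel) \<epsilon> UNIV"
    and ident: "\<And>i. distr M borel (\<epsilon> i) = distr M borel (\<epsilon> 0)"
    and int: "integrable M (\<epsilon> 0)" "integrable M (\<lambda>\<omega>. (\<epsilon> 0 \<omega>)\<^sup>2)"
    and mean: "expectation (\<epsilon> 0) = 0" and var: "variance (\<epsilon> 0) = \<sigma>\<^sup>2"
    and sq: "(\<lambda>n. \<Sum>i<n. (a n i)\<^sup>2) \<longlonglongrightarrow> v"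
    and negligible: "\<And>\<delta>. \<delta> > 0 \<Longrightarrow> \<forall>\<^sub>F n in sequentially. \<forall>i<n. \<bar>a n i\<bar> < \<delta>"
  shows "(\<lambda>n. \<integral>\<omega>. cis (\<Sum>i<n. a n i * \<epsilon> i \<omega>) \<partial>M) \<longlonglongrightarrow> complex_of_real (exp (- (\<sigma>\<^sup>2 * v / 2)))"
proof -
  have rv[measurable]: "random_variable borel (\<epsilon> i)" for i
    using indep by (simp add: indep_vars_def)
  define \<phi> where "\<phi> = char (distr M borel (\<epsilon> 0))"
  have char_ident: "char (distr M borel (\<epsilon> i)) = \<phi>" for i
    by (simp only: ident[of i] \<phi>_def)
  interpret D: real_distribution "distr M borel (\<epsilon> 0)"
    by (rule real_distribution_distr) (rule rv)
  have eq: "(\<integral>\<omega>. cis (\<Sum>i<n. a n i * \<epsilon> i \<omega>) \<partial>M) = (\<Prod>i<n. \<phi> (a n i))" for n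
  proof -
    have "(\<integral>\<omega>. cis (\<Sum>i<n. a n i * \<epsilon> i \<omega>) \<partial>M) = char (distr M borel (\<lambda>\<omega>. \<Sum>i<n. a n i * \<epsilon> i \<omega>)) 1"
      by (simp add: char_def integral_distr cis_conv_exp)
    also have "\<dots> = (\<Prod>i<n. char (distr M borel (\<lambda>\<omega>. a n i * \<epsilon> i \<omega>)) 1)"
    proof (rule char_distr_sum)
      show "indep_vars (\<lambda>i. borel) (\<lambda>i \<omega>. a n i * \<epsilon> i \<omega>) {..<n}"
        by (rule indep_vars_compose2[where X = \<epsilon> and M' = "\<lambda>_. borel"])
          (auto intro: indep_vars_subset[OF indep])
    qed
    also have "\<dots> = (\<Prod>i<n. char (distr M borel (\<epsilon> i)) (a n i))"
      by (simp add: char_def integral_distr)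
    finally show ?thesis by (simp only: char_ident)
  qed
  define \<psi> where "\<psi> b = complex_of_real (exp (- (\<sigma>\<^sup>2 * b\<^sup>2 / 2)))" for b
  have lim: "(\<lambda>n. \<Prod>i<n. \<psi> (a n i)) \<longlonglongrightarrow> complex_of_real (exp (- (\<sigma>\<^sup>2 * v / 2)))"
  proof -
    have "(\<Prod>i<n. \<psi> (a n i)) = complex_of_real (exp (- (\<sigma>\<^sup>2 * (\<Sum>i<n. (a n i)\<^sup>2) / 2)))" for n
      by (simp add: \<psi>_def sum_distrib_left sum_divide_distrib exp_sum flip: sum_negf)
    moreover have "(\<lambda>n. complex_of_real (exp (- (\<sigma>\<^sup>2 * (\<Sum>i<n. (a n i)\<^sup>2) / 2)))) \<longlonglongrightarrow> complex_of_real (exp (- (\<sigma>\<^sup>2 * v / 2)))"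
      by (intro tendsto_intros sq) simp_all
    ultimately show ?thesis by simp
  qed
  have "(\<lambda>n. (\<Prod>i<n. \<phi> (a n i)) - (\<Prod>i<n. \<psi> (a n i))) \<longlonglongrightarrow> 0"
  proof (rule tendstoI)
    fix r :: real assume "r > 0"
    define e where "e = r / (2 * (\<bar>v\<bar> + 1))"
    have "e > 0" using \<open>r > 0\<close> by (simp add: e_def)
    obtain \<delta> where d: "\<delta> > 0" "\<And>b. \<bar>b\<bar> < \<delta> \<Longrightarrow> cmod (\<phi> b - \<psi> b) \<le> e * b\<^sup>2"
      using char_approx_gaussian[OF rv int mean var \<open>e > 0\<close>] unfolding \<phi>_def \<psi>_def by blast
    have "\<forall>\<^sub>F n in sequentially. (\<Sum>i<n. (a n i)\<^sup>2) < \<bar>v\<bar> + 1"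
      by (rule order_tendstoD(2)[OF sq]) simp
    with negligible[OF d(1)]
    show "\<forall>\<^sub>F n in sequentially. dist ((\<Prod>i<n. \<phi> (a n i)) - (\<Prod>i<n. \<psi> (a n i))) 0 < r"
    proof eventually_elim
      case (elim n)
      have "cmod ((\<Prod>i<n. \<phi> (a n i)) - (\<Prod>i<n. \<psi> (a n i))) \<le> (\<Sum>i<n. cmod (\<phi> (a n i) - \<psi> (a n i)))"
        by (rule norm_prod_diff) (auto simp: \<phi>_def \<psi>_def D.cmod_char_le_1)
      also have "\<dots> \<le> (\<Sum>i<n. e * (a n i)\<^sup>2)"
        using elim(1) by (intro sum_mono d) auto
      also have "\<dots> \<le> e * (\<bar>v\<bar> + 1)"
        using elim(2) \<open>e > 0\<close> by (simp flip: sum_distrib_left)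
      also have "\<dots> = r / 2" by (simp add: e_def add_nonneg_eq_0_iff field_simps)
      finally show ?case using \<open>r > 0\<close> by simp
    qed
  qed
  from tendsto_add[OF this lim] show ?thesis by (simp add: eq)
qed

text \<open>Convergence of the means forces \<open>s n / n\<close> to 0, as a difference of
  consecutive partial sums. Late terms are then below \<open>\<delta> * i\<close>, and the finitely
  many early ones are below a fixed sum. In this way convergence of the Gram matrices alone makes
  the weights of the central limit theorem uniformly small.\<close>

lemma convergent_mean_negligible:
  fixes s :: "nat \<Rightarrow> real"
  assumes nn: "\<And>i. s i \<ge> 0" and lim: "(\<lambda>n. (\<Sum>i<n. s i) / real n) \<longlonglongrightarrow> L" and "\<delta> > 0"
  shows "\<forall>\<^sub>F n in sequentially. \<forall>i<n. s i < \<delta> * real n"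
proof -
  \<comment> \<open>The factor \<open>1 + 1 / real n\<close> changes the denominator from
    \<open>Suc n\<close> to \<open>n\<close>, so for positive \<open>n\<close> the difference is
    exactly \<open>s n / n\<close>.\<close>
  have "(\<lambda>n. (\<Sum>i<Suc n. s i) / real (Suc n) * (1 + 1 / real n) - (\<Sum>i<n. s i) / real n) \<longlonglongrightarrow> L * (1 + 0) - L"
    by (intro tendsto_intros LIMSEQ_Suc[OF lim] lim lim_1_over_n)
  then have "(\<lambda>n. (\<Sum>i<Suc n. s i) / real (Suc n) * (1 + 1 / real n) - (\<Sum>i<n. s i) / real n) \<longlonglongrightarrow> 0"
    by simp
  from order_tendstoD(2)[OF this \<open>\<delta> > 0\<close>]
  obtain N where N: "\<And>n. n \<ge> N \<Longrightarrow>
      (\<Sum>i<Suc n. s i) / real (Suc n) * (1 + 1 / real n) - (\<Sum>i<n. s i) / real n < \<delta>"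
    unfolding eventually_sequentially by blast
  have late: "s n < \<delta> * real n" if "n \<ge> Suc N" for n
  proof -
    have "n > 0" using that by simp
    have "(\<Sum>i<Suc n. s i) / real (Suc n) * (1 + 1 / real n) = (\<Sum>i<Suc n. s i) / real n"
    proof -
      have "1 + 1 / real n = real (Suc n) / real n" using \<open>n > 0\<close> by (simp add: field_simps)
      then show ?thesis by (simp del: sum.lessThan_Suc of_nat_Suc)
    qed
    then have "(\<Sum>i<Suc n. s i) / real (Suc n) * (1 + 1 / real n) - (\<Sum>i<n. s i) / real n = s n / real n"
      by (simp add: add_divide_distrib)
    with N[of n] that \<open>n > 0\<close> show ?thesis by (simp add: pos_divide_less_eq)
  qed
  have "\<forall>\<^sub>F n in sequentially. (\<Sum>i<Suc N. s i) / \<delta> < real n"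
    using filterlim_real_sequentially by (rule filterlim_at_top_dense[THEN iffD1, rule_format])
  then show ?thesis
  proof eventually_elim
    case (elim n)
    show ?case
    proof (intro allI impI)
      fix i assume "i < n"
      show "s i < \<delta> * real n"
      proof (cases "i < Suc N")
        case True
        then have "s i \<le> (\<Sum>i<Suc N. s i)" using nn by (intro member_le_sum) auto
        then show ?thesis using elim \<open>\<delta> > 0\<close> by (simp add: field_simps)
      next
        case False
        then have "s i < \<delta> * real i" by (intro late) simp
        also have "\<dots> \<le> \<delta> * real n" using \<open>i < n\<close> \<open>\<delta> > 0\<close> by simp
        finally show ?thesis .
      qed
    qed
  qed
qed

section \<open>Linear algebra\<close>

lemma norm_matrix_vector_component_le:
  fixes A :: "real^'n^'m"
  shows "\<bar>(A *v x) $ j\<bar> \<le> norm A * norm x"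
proof -
  have "\<bar>(A *v x) $ j\<bar> \<le> norm (A $ j) * norm x"
    unfolding matrix_vector_mul_component by (rule Cauchy_Schwarz_ineq2)
  also have "\<dots> \<le> norm A * norm x"
    by (intro mult_right_mono Finite_Cartesian_Product.norm_nth_le) simp
  finally show ?thesis .
qed

lemma norm_matrix_vector_mult_le:
  fixes A :: "real^'n^'m"
  shows "norm (A *v x) \<le> CARD('m) * norm A * norm x"
proof -
  have "norm (A *v x) \<le> (\<Sum>j\<in>UNIV. \<bar>(A *v x) $ j\<bar>)" by (rule norm_le_l1_cart)
  also have "\<dots> \<le> (\<Sum>j\<in>(UNIV :: 'm set). norm A * norm x)"
    by (intro sum_mono norm_matrix_vector_component_le)
  finally show ?thesis by (simp add: mult.assoc)
qed

text \<open>The constant is the minimum of the quadratic form on the compact unit sphere;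
  homogeneity extends the bound to all vectors.\<close>

lemma positive_definite_coercive:
  fixes C :: "real^'p^'p"
  assumes "positive_definite C"
  obtains l where "l > 0" "\<And>u. l * (norm u)\<^sup>2 \<le> u \<bullet> (C *v u)"
proof -
  let ?S = "sphere (0 :: real^'p) 1"
  have "?S \<noteq> {}" by simp
  moreover have "continuous_on ?S (\<lambda>u. u \<bullet> (C *v u))"
    by (intro continuous_intros linear_continuous_on_compose[OF continuous_on_id]) auto
  ultimately obtain v where v: "v \<in> ?S" "\<And>u. u \<in> ?S \<Longrightarrow> v \<bullet> (C *v v) \<le> u \<bullet> (C *v u)"
    using continuous_attains_inf[of ?S "\<lambda>u. u \<bullet> (C *v u)"] by auto
  have "v \<noteq> 0" using v(1) by auto
  show ?thesis
  proof (rule that)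
    show "v \<bullet> (C *v v) > 0" using assms \<open>v \<noteq> 0\<close> by (simp add: positive_definite_def)
    show "v \<bullet> (C *v v) * (norm u)\<^sup>2 \<le> u \<bullet> (C *v u)" for u
    proof (cases "u = 0")
      case False
      define w where "w = (1 / norm u) *\<^sub>R u"
      have w: "w \<in> ?S" using False by (simp add: w_def)
      have u: "u = norm u *\<^sub>R w" using False by (simp add: w_def)
      have "u \<bullet> (C *v u) = (norm u)\<^sup>2 * (w \<bullet> (C *v w))"
        by (subst (1 2) u) (simp add: matrix_vector_mult_scaleR power2_eq_square)
      then show ?thesis using v(2)[OF w] by (simp add: mult.commute mult_right_mono)
    qed simp
  qed
qed

text \<open>Half of the constant \<open>l\<close> is given up to absorb the perturbation
  \<open>Cn n - C\<close>, simultaneously for all \<open>u\<close>.\<close>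

lemma eventually_coercive:
  fixes C :: "real^'p^'p"
  assumes lim: "Cn \<longlonglongrightarrow> C" and "l > 0" and l: "\<And>u. l * (norm u)\<^sup>2 \<le> u \<bullet> (C *v u)"
  shows "\<forall>\<^sub>F n in sequentially. \<forall>u. l / 2 * (norm u)\<^sup>2 \<le> u \<bullet> (Cn n *v u)"
proof -
  have "(\<lambda>n. real CARD('p) * norm (Cn n - C)) \<longlonglongrightarrow> real CARD('p) * 0"
    using lim by (intro tendsto_mult_left tendsto_norm_zero) (simp add: LIM_zero_iff)
  from order_tendstoD(2)[OF this, of "l / 2"] \<open>l > 0\<close>
  have "\<forall>\<^sub>F n in sequentially. CARD('p) * norm (Cn n - C) < l / 2" by simp
  then show ?thesis
  proof eventually_elim
    case (elim n)
    show ?case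
    proof
      fix u :: "real^'p"
      have "\<bar>u \<bullet> ((Cn n - C) *v u)\<bar> \<le> norm u * norm ((Cn n - C) *v u)"
        by (rule Cauchy_Schwarz_ineq2)
      also have "\<dots> \<le> norm u * (CARD('p) * norm (Cn n - C) * norm u)"
        by (intro mult_left_mono norm_matrix_vector_mult_le) simp
      also have "\<dots> \<le> norm u * (l / 2 * norm u)"
        using elim by (intro mult_left_mono mult_right_mono) auto
      finally have "\<bar>u \<bullet> ((Cn n - C) *v u)\<bar> \<le> l / 2 * (norm u)\<^sup>2" by (simp add: power2_eq_square mult_ac)
      moreover have "u \<bullet> (Cn n *v u) = u \<bullet> (C *v u) + u \<bullet> ((Cn n - C) *v u)"
        by (simp add: matrix_vector_mult_diff_rdistrib inner_diff_right)
      ultimately show "l / 2 * (norm u)\<^sup>2 \<le> u \<bullet> (Cn n *v u)" using l[of u] by linarith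
    qed
  qed
qed

text \<open>A kernel vector of the block matrix \<open>D\<close> vanishes off \<open>A\<close>
  because of the identity block, and then its \<open>C\<close>-form is 0, so positive definiteness
  makes \<open>D\<close> invertible. For \<open>u\<close> supported in \<open>A\<close>, the vectors
  \<open>C *v u\<close> and \<open>D *v u\<close> agree on \<open>A\<close>, while
  \<open>D *v u\<close> vanishes elsewhere; thus the zero columns of the padded inverse lose
  nothing.\<close>

lemma sub_inv_pad_left_inverse:
  fixes C :: "real^'p^'p"
  assumes pd: "positive_definite C" and supp: "\<And>j. j \<notin> A \<Longrightarrow> u $ j = 0"
  shows "sub_inv_pad C A *v (C *v u) = u"
proof -
  define D :: "real^'p^'p" where
    "D = (\<chi> j k. if j \<in> A \<and> k \<in> A then C $ j $ k else if j = k then 1 else 0)"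
  have D_out: "(D *v v) $ j = v $ j" if "j \<notin> A" for v j
  proof -
    have "(D *v v) $ j = (\<Sum>k\<in>UNIV. if j = k then v $ k else 0)"
      unfolding matrix_vector_mult_def using that by (auto simp: D_def if_distrib[where f = "\<lambda>z. z * _"] cong: if_cong)
    then show ?thesis by simp
  qed
  have D_in: "(D *v v) $ j = (C *v v) $ j" if "j \<in> A" "\<And>k. k \<notin> A \<Longrightarrow> v $ k = 0" for v j
    unfolding matrix_vector_mult_def using that by (auto simp: D_def intro!: sum.cong)
  have "v = 0" if Dv: "D *v v = 0" for v
  proof -
    have v0: "v $ k = 0" if "k \<notin> A" for k using D_out[OF that, of v] Dv by simp
    have "v \<bullet> (C *v v) = (\<Sum>j\<in>UNIV. v $ j * (C *v v) $ j)" by (simp add: inner_vec_def)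
    also have "\<dots> = 0"
    proof (rule sum.neutral, rule ballI)
      fix j show "v $ j * (C *v v) $ j = 0"
        using v0[of j] D_in[OF _ v0, of j] Dv by (cases "j \<in> A") auto
    qed
    finally show ?thesis using pd unfolding positive_definite_def by force
  qed
  then have "invertible D"
    unfolding invertible_left_inverse matrix_left_invertible_ker by blast
  then have "matrix_inv D ** D = mat 1"
    unfolding invertible_def matrix_inv_def by (rule someI2_ex) blast
  then have inv: "matrix_inv D *v (D *v u) = u"
    by (simp add: matrix_vector_mul_assoc)
  show ?thesis
  proof (rule vec_eq_iff[THEN iffD2, rule_format])
    fix j
    show "(sub_inv_pad C A *v (C *v u)) $ j = u $ j"
    proof (cases "j \<in> A")
      case True
      have "(sub_inv_pad C A *v (C *v u)) $ j = (\<Sum>k\<in>UNIV. sub_inv_pad C A $ j $ k * (C *v u) $ k)"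
        by (simp add: matrix_vector_mult_def)
      also have "\<dots> = (\<Sum>k\<in>UNIV. matrix_inv D $ j $ k * (D *v u) $ k)"
      proof (rule sum.cong[OF refl])
        fix k
        show "sub_inv_pad C A $ j $ k * (C *v u) $ k = matrix_inv D $ j $ k * (D *v u) $ k"
          using True D_in[OF _ supp, of k] D_out[of k u] supp[of k]
          by (cases "k \<in> A") (simp_all add: sub_inv_pad_def Let_def flip: D_def)
      qed
      also have "\<dots> = (matrix_inv D *v (D *v u)) $ j" by (simp add: matrix_vector_mult_def)
      finally show ?thesis by (simp add: inv)
    next
      case False
      then show ?thesis using supp by (simp add: matrix_vector_mult_def sub_inv_pad_def Let_def)
    qed
  qed
qed

lemma sub_inv_pad_restrict: "sub_inv_pad C A *v restrict_vec A v = sub_inv_pad C A *v v"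
  by (auto simp: vec_eq_iff matrix_vector_mult_def restrict_vec_def sub_inv_pad_def Let_def intro!: sum.cong)

text \<open>This identifies the covariance \<open>L C L\<^sup>T\<close> of \<open>L W\<close>, where \<open>W\<close> has covariance \<open>C\<close>.\<close>
lemma sub_inv_pad_sandwich:
  fixes C :: "real^'p^'p" and A :: "'p set"
  assumes "positive_definite C"
  defines "L \<equiv> sub_inv_pad C A"
  shows "(transpose L *v t) \<bullet> (C *v (transpose L *v t)) = t \<bullet> (L *v t)"
proof -
  have "(transpose L *v t) $ j = 0" if "j \<notin> A" for j
    using that by (simp add: matrix_vector_mult_def transpose_def L_def sub_inv_pad_def Let_def)
  then have "L *v (C *v (transpose L *v t)) = transpose L *v t"
    unfolding L_def by (intro sub_inv_pad_left_inverse assms)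
  then have "t \<bullet> (L *v (C *v (transpose L *v t))) = t \<bullet> (transpose L *v t)" by simp
  then show ?thesis
    by (metis dot_lmul_matrix inner_commute transpose_matrix_vector transpose_transpose)
qed

section \<open>Minimisers of the rescaled objective\<close>

definition scaled_gram :: "(nat \<Rightarrow> real^'p) \<Rightarrow> nat \<Rightarrow> real^'p^'p" where
  "scaled_gram x n = (1 / real n) *\<^sub>R (\<Sum>i<n. (\<chi> j k. x i $ j * x i $ k))"

definition score :: "(nat \<Rightarrow> real^'p) \<Rightarrow> (nat \<Rightarrow> real) \<Rightarrow> nat \<Rightarrow> real^'p" where
  "score x e n = (1 / sqrt (real n)) *\<^sub>R (\<Sum>i<n. e i *\<^sub>R x i)"

text \<open>The objective at \<open>b = b\<^sub>0 + u / \<surd>n\<close>, up to the additive constant \<open>\<Sum> \<epsilon>\<^sub>i\<^sup>2\<close>.\<close>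
definition local_obj :: "real^'p^'p \<Rightarrow> real^'p \<Rightarrow> nat \<Rightarrow> real \<Rightarrow> real \<Rightarrow> real^'p \<Rightarrow> real^'p \<Rightarrow> real" where
  "local_obj C W n \<eta> \<alpha> b0 b =
     (sqrt n *\<^sub>R (b - b0)) \<bullet> (C *v (sqrt n *\<^sub>R (b - b0))) - 2 * (W \<bullet> (sqrt n *\<^sub>R (b - b0)))
     + \<eta> / \<alpha> * (\<Sum>j\<in>UNIV. sqrt (1 + 2 * \<alpha> * \<bar>b $ j\<bar>) - 1)"

lemma scaled_gram_mult: "scaled_gram x n *v v = (1 / real n) *\<^sub>R (\<Sum>i<n. (x i \<bullet> v) *\<^sub>R x i)"
proof -
  have "(\<Sum>k\<in>UNIV. (\<Sum>i<n. x i $ j * x i $ k) * v $ k) = (\<Sum>i<n. (x i \<bullet> v) * x i $ j)" for j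
    unfolding sum_distrib_right inner_vec_def
    by (subst sum.swap) (simp add: mult_ac)
  then show ?thesis
    by (simp add: vec_eq_iff scaled_gram_def matrix_vector_mult_def sum_divide_distrib[symmetric])
qed

lemma scaled_gram_symmetric: "transpose (scaled_gram x n) = scaled_gram x n"
  by (simp add: vec_eq_iff scaled_gram_def transpose_def mult.commute)

lemma scaled_gram_quadratic: "u \<bullet> (scaled_gram x n *v u) = (\<Sum>i<n. (x i \<bullet> u)\<^sup>2) / real n"
  by (simp add: scaled_gram_mult inner_sum_right power2_eq_square inner_commute)

lemma penalized_obj_eq_local_obj:
  assumes "n > 0"
  shows "penalized_obj x (\<lambda>i. x i \<bullet> b0 + e i) n \<eta> \<alpha> b
    = (\<Sum>i<n. (e i)\<^sup>2) + local_obj (scaled_gram x n) (score x e n) n \<eta> \<alpha> b0 b"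
proof -
  define u where "u = sqrt n *\<^sub>R (b - b0)"
  have "u \<bullet> (scaled_gram x n *v u) = (\<Sum>i<n. (x i \<bullet> (b - b0))\<^sup>2)"
    unfolding scaled_gram_quadratic using assms
    by (simp add: u_def power_mult_distrib flip: sum_distrib_left)
  moreover have "score x e n \<bullet> u = (\<Sum>i<n. e i * (x i \<bullet> (b - b0)))"
    using assms by (simp add: score_def u_def inner_sum_left)
  moreover have "(\<Sum>i<n. (x i \<bullet> b0 + e i - x i \<bullet> b)\<^sup>2)
      = (\<Sum>i<n. (e i)\<^sup>2) + (\<Sum>i<n. (x i \<bullet> (b - b0))\<^sup>2) - 2 * (\<Sum>i<n. e i * (x i \<bullet> (b - b0)))"
    by (simp add: sum_distrib_left power2_eq_square inner_diff_right algebra_simps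
        flip: sum.distrib sum_subtractf)
  ultimately show ?thesis
    unfolding penalized_obj_def local_obj_def u_def[symmetric] by simp
qed

section \<open>Deterministic consequences of minimality\<close>

lemma local_obj_min_slice:
  fixes C :: "real^'p^'p"
  assumes sym: "transpose C = C" and min: "\<And>b'. local_obj C W n \<eta> \<alpha> b0 b \<le> local_obj C W n \<eta> \<alpha> b0 b'"
  shows "\<eta> / \<alpha> * sqrt (1 + 2 * \<alpha> * \<bar>b $ j\<bar>)
    \<le> \<eta> / \<alpha> * sqrt (1 + 2 * \<alpha> * \<bar>b $ j + s\<bar>) + (sqrt n * s)\<^sup>2 * C $ j $ j
      + 2 * (sqrt n * s) * ((C *v (sqrt n *\<^sub>R (b - b0))) $ j - W $ j)"
proof -
  define u where "u = sqrt n *\<^sub>R (b - b0)"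
  define r where "r = sqrt n * s"
  \<comment> \<open>The competitor differs from the minimiser in coordinate \<open>j\<close> only,
    so all other penalty terms cancel. The choice \<open>s = - b $ j\<close> later gives sparsity,
    and small \<open>s\<close> gives stationarity.\<close>
  define b' where "b' = b + s *\<^sub>R axis j 1"
  have u': "sqrt n *\<^sub>R (b' - b0) = u + r *\<^sub>R axis j 1"
    by (simp add: u_def r_def b'_def algebra_simps)
  have sw: "u \<bullet> (C *v axis j 1) = (C *v u) $ j"
    by (metis cart_eq_inner_axis dot_lmul_matrix inner_commute sym vector_transpose_matrix)
  have quad: "(u + r *\<^sub>R axis j 1) \<bullet> (C *v (u + r *\<^sub>R axis j 1)) - 2 * (W \<bullet> (u + r *\<^sub>R axis j 1))
    = u \<bullet> (C *v u) - 2 * (W \<bullet> u) + r\<^sup>2 * C $ j $ j + 2 * r * ((C *v u) $ j - W $ j)"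
  proof -
    have "axis j 1 \<bullet> (C *v axis j 1) = C $ j $ j"
      by (simp add: inner_axis' matrix_vector_mul_component inner_axis)
    moreover have "axis j 1 \<bullet> (C *v u) = (C *v u) $ j" by (simp add: inner_axis')
    moreover have "W \<bullet> axis j 1 = W $ j" by (simp add: inner_axis)
    ultimately show ?thesis using sw
      by (simp add: inner_add_left inner_add_right matrix_vector_right_distrib
          matrix_vector_mult_scaleR power2_eq_square algebra_simps)
  qed
  have split: "(\<Sum>k\<in>UNIV. sqrt (1 + 2 * \<alpha> * \<bar>v $ k\<bar>) - 1)
      = sqrt (1 + 2 * \<alpha> * \<bar>v $ j\<bar>) - 1 + (\<Sum>k\<in>UNIV-{j}. sqrt (1 + 2 * \<alpha> * \<bar>v $ k\<bar>) - 1)" for v :: "real^'p"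
    by (rule sum.remove) auto
  have rest: "(\<Sum>k\<in>UNIV-{j}. sqrt (1 + 2 * \<alpha> * \<bar>b' $ k\<bar>) - 1) = (\<Sum>k\<in>UNIV-{j}. sqrt (1 + 2 * \<alpha> * \<bar>b $ k\<bar>) - 1)"
    by (rule sum.cong) (auto simp: b'_def axis_def)
  have "b' $ j = b $ j + s" by (simp add: b'_def)
  with min[of b'] show ?thesis
    unfolding local_obj_def u' quad u_def[symmetric] r_def[symmetric] split rest
    by (simp only: distrib_left right_diff_distrib)
qed

text \<open>Only \<open>sqrt p\<close> occurs in the denominator. With \<open>p\<close> belonging to
  the true coefficient, the penalty difference is controlled before anything is known about the
  estimate.\<close>

lemma sqrt_diff_le:
  fixes p q :: real
  assumes "p > 0" "q \<ge> 0" shows "sqrt p - sqrt q \<le> \<bar>p - q\<bar> / sqrt p"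
proof (cases "q \<le> p")
  case True
  have "q \<le> sqrt p * sqrt q"
    using mult_right_mono[OF real_sqrt_le_mono[OF True], of "sqrt q"] assms by simp
  then have "(sqrt p - sqrt q) * sqrt p \<le> p - q" using assms by (simp add: left_diff_distrib mult.commute[of "sqrt q"])
  then show ?thesis using assms True by (simp add: le_divide_eq)
next
  case False
  then have "sqrt p - sqrt q \<le> 0" by simp
  also have "0 \<le> \<bar>p - q\<bar> / sqrt p" using assms by simp
  finally show ?thesis .
qed

text \<open>Compare with \<open>b0\<close>. Where \<open>b0\<close> vanishes, its penalty is no
  larger than that of the minimiser; elsewhere the gain is at most linear in \<open>u\<close>.
  Coercivity then bounds a quadratic in \<open>norm u\<close> by a linear term, and one factor
  \<open>norm u\<close> cancels.\<close>

lemma local_obj_min_rate: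
  fixes C :: "real^'p^'p"
  assumes min: "\<And>b'. local_obj C W n \<eta> \<alpha> b0 b \<le> local_obj C W n \<eta> \<alpha> b0 b'"
    and pos: "n > 0" "\<eta> > 0" "\<alpha> > 0"
    and coercive: "\<And>u. l * (norm u)\<^sup>2 \<le> u \<bullet> (C *v u)"
  shows "l * norm (sqrt n *\<^sub>R (b - b0))
    \<le> 2 * norm W + (\<Sum>j\<in>UNIV. if b0 $ j = 0 then 0 else 2 * (\<eta> / (sqrt n * sqrt (1 + 2 * \<alpha> * \<bar>b0 $ j\<bar>))))"
proof -
  define u where "u = sqrt n *\<^sub>R (b - b0)"
  \<comment> \<open>Twice the slope of the penalty at \<open>b0 $ j\<close>, measured on the scale
    of \<open>u\<close>; the factor 2 is the price of \<open>sqrt_diff_le\<close>.\<close>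
  define d where "d j = (if b0 $ j = 0 then 0 else 2 * (\<eta> / (sqrt n * sqrt (1 + 2 * \<alpha> * \<bar>b0 $ j\<bar>))))" for j
  have d: "\<eta> / \<alpha> * (sqrt (1 + 2 * \<alpha> * \<bar>b0 $ j\<bar>) - sqrt (1 + 2 * \<alpha> * \<bar>b $ j\<bar>)) \<le> d j * norm u" for j
  proof (cases "b0 $ j = 0")
    case True
    then show ?thesis using pos by (simp add: d_def mult_le_0_iff divide_le_0_iff)
  next
    case False
    let ?r = "sqrt (1 + 2 * \<alpha> * \<bar>b0 $ j\<bar>)"
    have "?r > 0" using pos by (simp add: add_pos_nonneg)
    have "?r - sqrt (1 + 2 * \<alpha> * \<bar>b $ j\<bar>) \<le> \<bar>(1 + 2 * \<alpha> * \<bar>b0 $ j\<bar>) - (1 + 2 * \<alpha> * \<bar>b $ j\<bar>)\<bar> / ?r"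
      using pos by (intro sqrt_diff_le) (auto simp: add_pos_nonneg)
    also have "\<dots> = 2 * \<alpha> * \<bar>\<bar>b0 $ j\<bar> - \<bar>b $ j\<bar>\<bar> / ?r"
      using pos by (simp add: abs_mult flip: right_diff_distrib)
    also have "\<dots> \<le> 2 * \<alpha> * \<bar>(b - b0) $ j\<bar> / ?r"
      using pos \<open>?r > 0\<close> by (intro divide_right_mono mult_left_mono) auto
    also have "\<dots> = 2 * \<alpha> * (\<bar>u $ j\<bar> / sqrt n) / ?r"
      using pos by (simp add: u_def abs_mult)
    also have "\<dots> \<le> 2 * \<alpha> * (norm u / sqrt n) / ?r"
      using pos \<open>?r > 0\<close> by (intro divide_right_mono mult_left_mono component_le_norm_cart) auto
    finally have "\<eta> / \<alpha> * (?r - sqrt (1 + 2 * \<alpha> * \<bar>b $ j\<bar>)) \<le> \<eta> / \<alpha> * (2 * \<alpha> * (norm u / sqrt n) / ?r)"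
      using pos by (intro mult_left_mono) auto
    also have "\<dots> = d j * norm u"
      using pos False by (simp add: d_def)
    finally show ?thesis .
  qed
  have "u \<bullet> (C *v u) - 2 * (W \<bullet> u) \<le>
      (\<Sum>j\<in>UNIV. \<eta> / \<alpha> * (sqrt (1 + 2 * \<alpha> * \<bar>b0 $ j\<bar>) - sqrt (1 + 2 * \<alpha> * \<bar>b $ j\<bar>)))"
  proof -
    have "(\<Sum>j\<in>UNIV. \<eta> / \<alpha> * (sqrt (1 + 2 * \<alpha> * \<bar>b0 $ j\<bar>) - sqrt (1 + 2 * \<alpha> * \<bar>b $ j\<bar>)))
        = \<eta> / \<alpha> * ((\<Sum>j\<in>UNIV. sqrt (1 + 2 * \<alpha> * \<bar>b0 $ j\<bar>) - 1) - (\<Sum>j\<in>UNIV. sqrt (1 + 2 * \<alpha> * \<bar>b $ j\<bar>) - 1))"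
      unfolding sum_distrib_left[symmetric] by (simp add: sum_subtractf)
    also have "\<dots> = \<eta> / \<alpha> * (\<Sum>j\<in>UNIV. sqrt (1 + 2 * \<alpha> * \<bar>b0 $ j\<bar>) - 1)
        - \<eta> / \<alpha> * (\<Sum>j\<in>UNIV. sqrt (1 + 2 * \<alpha> * \<bar>b $ j\<bar>) - 1)"
      by (rule right_diff_distrib)
    moreover have "local_obj C W n \<eta> \<alpha> b0 b0 = \<eta> / \<alpha> * (\<Sum>j\<in>UNIV. sqrt (1 + 2 * \<alpha> * \<bar>b0 $ j\<bar>) - 1)"
      by (simp add: local_obj_def)
    moreover have "local_obj C W n \<eta> \<alpha> b0 b = u \<bullet> (C *v u) - 2 * (W \<bullet> u)
        + \<eta> / \<alpha> * (\<Sum>j\<in>UNIV. sqrt (1 + 2 * \<alpha> * \<bar>b $ j\<bar>) - 1)"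
      by (simp only: local_obj_def u_def)
    ultimately show ?thesis using min[of b0] by linarith
  qed
  also have "\<dots> \<le> (\<Sum>j\<in>UNIV. d j * norm u)" by (intro sum_mono d)
  finally have "u \<bullet> (C *v u) \<le> 2 * (W \<bullet> u) + (\<Sum>j\<in>UNIV. d j) * norm u"
    by (simp add: sum_distrib_right)
  also have "\<dots> \<le> 2 * (norm W * norm u) + (\<Sum>j\<in>UNIV. d j) * norm u"
    using norm_cauchy_schwarz[of W u] by simp
  finally have main: "l * norm u * norm u \<le> (2 * norm W + (\<Sum>j\<in>UNIV. d j)) * norm u"
    using coercive[of u] by (simp add: power2_eq_square algebra_simps)
  have "(\<Sum>j\<in>UNIV. d j) \<ge> 0" using pos by (intro sum_nonneg) (simp add: d_def)
  then have "l * norm u \<le> 2 * norm W + (\<Sum>j\<in>UNIV. d j)"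
    using main by (cases "u = 0") auto
  then show ?thesis by (simp add: u_def d_def)
qed

text \<open>Setting the spurious coordinate to zero must not lower the objective. Both the penalty
  saved and the change of the quadratic part carry a factor \<open>\<bar>u $ j\<bar>\<close>, which
  cancels. What remains bounds \<open>\<eta> / sqrt n\<close> by quantities that stay bounded, and
  this fails for large \<open>n\<close>.\<close>

lemma local_obj_min_nonzero_bound:
  fixes C :: "real^'p^'p"
  assumes sym: "transpose C = C" and min: "\<And>b'. local_obj C W n \<eta> \<alpha> b0 b \<le> local_obj C W n \<eta> \<alpha> b0 b'"
    and pos: "n > 0" "\<eta> > 0" "\<alpha> > 0" and j: "b0 $ j = 0" "b $ j \<noteq> 0"
  defines "u \<equiv> sqrt n *\<^sub>R (b - b0)"
  shows "2 * (\<eta> / sqrt n) \<le>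
    (sqrt (1 + 2 * (\<alpha> / sqrt n) * norm u) + 1) * (norm u * norm C + 2 * (norm C * norm u + norm W))"
proof -
  define q where "q = sqrt (1 + 2 * \<alpha> * \<bar>b $ j\<bar>)"
  define g where "g = (C *v u) $ j - W $ j"
  have uj: "sqrt n * b $ j = u $ j" "u $ j \<noteq> 0" using pos j by (auto simp: u_def)
  have "\<alpha> * \<bar>b $ j\<bar> = \<alpha> / sqrt n * \<bar>u $ j\<bar>"
    unfolding uj(1)[symmetric] using pos by (simp add: abs_mult)
  then have q': "q = sqrt (1 + 2 * (\<alpha> / sqrt n) * \<bar>u $ j\<bar>)" by (simp add: q_def)
  have "q \<ge> 0" using pos by (simp add: q_def)
  have "q\<^sup>2 = 1 + 2 * (\<alpha> / sqrt n) * \<bar>u $ j\<bar>" unfolding q' using pos by simp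
  \<comment> \<open>Rationalising \<open>q - 1\<close> exposes the factor
    \<open>\<bar>u $ j\<bar>\<close> in the penalty saved.\<close>
  then have qq: "(q - 1) * (q + 1) = 2 * (\<alpha> / sqrt n) * \<bar>u $ j\<bar>"
    by (simp add: power2_eq_square algebra_simps)
  have g_le: "\<bar>g\<bar> \<le> norm C * norm u + norm W"
    using norm_matrix_vector_component_le[of C u j] component_le_norm_cart[of W j]
    unfolding g_def by linarith
  have Cjj: "\<bar>C $ j $ j\<bar> \<le> norm C"
    using component_le_norm_cart[of "C $ j" j] Finite_Cartesian_Product.norm_nth_le[of C j] by linarith
  have "\<eta> / \<alpha> * (q - 1) \<le> (u $ j)\<^sup>2 * C $ j $ j - 2 * u $ j * g"
  proof -
    have "sqrt n * (- b $ j) = - (u $ j)" using uj(1) by simp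
    from local_obj_min_slice[OF sym min, of j "- b $ j", unfolded this, folded u_def q_def]
    show ?thesis by (simp add: g_def right_diff_distrib)
  qed
  also have "\<dots> \<le> \<bar>u $ j\<bar> * (\<bar>u $ j\<bar> * \<bar>C $ j $ j\<bar> + 2 * \<bar>g\<bar>)"
  proof -
    have "\<bar>u $ j\<bar> * (\<bar>u $ j\<bar> * \<bar>C $ j $ j\<bar> + 2 * \<bar>g\<bar>) = \<bar>(u $ j)\<^sup>2 * C $ j $ j\<bar> + \<bar>2 * u $ j * g\<bar>"
      by (simp add: abs_mult power2_eq_square distrib_left)
    then show ?thesis by linarith
  qed
  also have "\<dots> \<le> \<bar>u $ j\<bar> * (norm u * norm C + 2 * (norm C * norm u + norm W))"
    using g_le Cjj component_le_norm_cart[of u j]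
    by (intro mult_left_mono add_mono mult_mono) auto
  finally have "\<eta> / \<alpha> * (q - 1) * (q + 1) \<le>
      \<bar>u $ j\<bar> * (norm u * norm C + 2 * (norm C * norm u + norm W)) * (q + 1)"
    using \<open>q \<ge> 0\<close> by (intro mult_right_mono) auto
  moreover have "\<eta> / \<alpha> * (q - 1) * (q + 1) = \<bar>u $ j\<bar> * (2 * (\<eta> / sqrt n))"
    using qq pos by (simp add: mult.assoc)
  ultimately have "\<bar>u $ j\<bar> * (2 * (\<eta> / sqrt n)) \<le>
      \<bar>u $ j\<bar> * ((q + 1) * (norm u * norm C + 2 * (norm C * norm u + norm W)))"
    by (simp add: mult_ac)
  then have "2 * (\<eta> / sqrt n) \<le> (q + 1) * (norm u * norm C + 2 * (norm C * norm u + norm W))"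
    using mult_le_cancel_left_pos[of "\<bar>u $ j\<bar>"] uj(2) by (metis zero_less_abs_iff)
  also have "\<dots> \<le> (sqrt (1 + 2 * (\<alpha> / sqrt n) * norm u) + 1) * (norm u * norm C + 2 * (norm C * norm u + norm W))"
    unfolding q' using pos
    by (intro mult_right_mono add_right_mono real_sqrt_le_mono add_left_mono mult_left_mono component_le_norm_cart) auto
  finally show ?thesis .
qed

text \<open>At a nonzero coordinate the penalty is differentiable, so the derivative of the slice
  vanishes. The true value is half of the stated bound.\<close>

lemma local_obj_min_stationary:
  fixes C :: "real^'p^'p"
  assumes sym: "transpose C = C" and min: "\<And>b'. local_obj C W n \<eta> \<alpha> b0 b \<le> local_obj C W n \<eta> \<alpha> b0 b'"
    and pos: "n > 0" "\<eta> > 0" "\<alpha> > 0" and j: "b $ j \<noteq> 0"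
  shows "\<bar>(C *v (sqrt n *\<^sub>R (b - b0))) $ j - W $ j\<bar> \<le> \<eta> / (sqrt n * sqrt (1 + 2 * \<alpha> * \<bar>b $ j\<bar>))"
proof -
  define g where "g = (C *v (sqrt n *\<^sub>R (b - b0))) $ j - W $ j"
  define q where "q = sqrt (1 + 2 * \<alpha> * \<bar>b $ j\<bar>)"
  have "q > 0" using pos by (simp add: q_def add_pos_nonneg)
  define p where "p = 1 + 2 * \<alpha> * \<bar>b $ j\<bar>"
  have p: "p > 0" "sqrt p = q" using pos by (auto simp: p_def q_def add_pos_nonneg)
  define c where "c = 2 * \<alpha> * sgn (b $ j)"
  \<comment> \<open>The absolute value is replaced by its linear branch. The two agree for shifts
    smaller than \<open>\<bar>b $ j\<bar>\<close>, which is enough for a local minimum at 0.\<close>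
  define F where "F s = \<eta> / \<alpha> * sqrt (p + c * s) + (sqrt n * s)\<^sup>2 * C $ j $ j + 2 * (sqrt n * s) * g" for s
  have "(F has_real_derivative (\<eta> / \<alpha> * (c / (2 * q)) + 2 * sqrt n * g)) (at 0)"
    unfolding F_def using pos p
    by (auto intro!: derivative_eq_intros simp: field_simps)
  then have "\<eta> / \<alpha> * (c / (2 * q)) + 2 * sqrt n * g = 0"
  proof (rule DERIV_local_min)
    show "\<bar>b $ j\<bar> > 0" using j by simp
    show "\<forall>y. \<bar>0 - y\<bar> < \<bar>b $ j\<bar> \<longrightarrow> F 0 \<le> F y"
    proof (intro allI impI)
      fix y assume "\<bar>0 - y\<bar> < \<bar>b $ j\<bar>"
      then have "\<bar>b $ j + y\<bar> = \<bar>b $ j\<bar> + sgn (b $ j) * y" by (auto simp: sgn_if)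
      then have "1 + 2 * \<alpha> * \<bar>b $ j + y\<bar> = p + c * y"
        by (simp add: p_def c_def distrib_left)
      then show "F 0 \<le> F y"
        using local_obj_min_slice[OF sym min, of j y] unfolding F_def g_def by (simp add: p_def add.assoc)
    qed
  qed
  moreover have "\<eta> / \<alpha> * (c / (2 * q)) = \<eta> * sgn (b $ j) / q"
    using pos by (simp add: c_def)
  ultimately have "2 * sqrt n * g = - (\<eta> * sgn (b $ j) / q)" by linarith
  then have "\<bar>2 * sqrt n * g\<bar> = \<eta> / q"
    using pos j \<open>q > 0\<close> by (simp add: abs_mult abs_sgn_eq)
  then have "sqrt n * \<bar>g\<bar> * 2 = \<eta> / q" using pos by (simp add: abs_mult)
  moreover have "sqrt n * \<bar>g\<bar> \<ge> 0" by simp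
  ultimately have "sqrt n * \<bar>g\<bar> \<le> \<eta> / q" by linarith
  then show ?thesis using pos \<open>q > 0\<close> unfolding g_def q_def by (simp add: field_simps)
qed

section \<open>Asymptotics of the minimiser, uniform over bounded scores\<close>

lemma penalty_slope_vanishes:
  fixes \<eta> \<alpha> :: "nat \<Rightarrow> real"
  assumes eta: "(\<lambda>n. \<eta> n / real n powr (3/4)) \<longlonglongrightarrow> 0"
    and alpha: "(\<lambda>n. \<alpha> n / sqrt (real n)) \<longlonglongrightarrow> c" "0 < c" and "\<beta> > 0"
  shows "(\<lambda>n. \<eta> n / (sqrt n * sqrt (1 + 2 * \<alpha> n * \<beta>))) \<longlonglongrightarrow> 0"
proof -
  have "(\<lambda>n. 1 / sqrt (real n)) \<longlonglongrightarrow> 0"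
    by (rule tendsto_divide_0[OF tendsto_const filterlim_at_top_imp_at_infinity])
      (rule filterlim_compose[OF sqrt_at_top filterlim_real_sequentially])
  then have "(\<lambda>n. \<eta> n / real n powr (3/4) * (1 / sqrt (1 / sqrt (real n) + 2 * (\<alpha> n / sqrt (real n)) * \<beta>)))
      \<longlonglongrightarrow> 0 * (1 / sqrt (0 + 2 * c * \<beta>))"
    using assms by (intro tendsto_intros) auto
  then have "(\<lambda>n. \<eta> n / real n powr (3/4) * (1 / sqrt (1 / sqrt (real n) + 2 * (\<alpha> n / sqrt (real n)) * \<beta>))) \<longlonglongrightarrow> 0"
    by simp
  then show ?thesis
  proof (rule Lim_transform_eventually)
    show "\<forall>\<^sub>F n in sequentially. \<eta> n / real n powr (3/4) * (1 / sqrt (1 / sqrt (real n) + 2 * (\<alpha> n / sqrt (real n)) * \<beta>))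
        = \<eta> n / (sqrt n * sqrt (1 + 2 * \<alpha> n * \<beta>))"
      using eventually_gt_at_top[of 0]
    proof eventually_elim
      case (elim n)
      \<comment> \<open>The rate 3/4 splits into 1/2 from the rescaling of \<open>u\<close> and 1/4
        from \<open>sqrt (\<alpha> n)\<close>, since \<open>\<alpha> n\<close> grows like
        \<open>sqrt n\<close>.\<close>
      have "real n powr (3/4) = real n powr (1/2 + 1/2 * (1/2))" by simp
      also have "\<dots> = sqrt n * sqrt (sqrt n)"
        using elim by (simp only: powr_add powr_powr[symmetric] powr_half_sqrt) (simp add: powr_half_sqrt)
      finally have pw: "real n powr (3/4) = sqrt n * sqrt (sqrt n)" .
      have "sqrt (sqrt n) * sqrt (1 / sqrt (real n) + 2 * (\<alpha> n / sqrt (real n)) * \<beta>)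
          = sqrt (sqrt n * (1 / sqrt (real n) + 2 * (\<alpha> n / sqrt (real n)) * \<beta>))"
        by (rule real_sqrt_mult[symmetric])
      also have "sqrt n * (1 / sqrt (real n) + 2 * (\<alpha> n / sqrt (real n)) * \<beta>) = 1 + 2 * \<alpha> n * \<beta>"
        using elim by (simp add: distrib_left)
      finally show ?case unfolding pw by (simp add: mult.assoc)
    qed
  qed
qed

text \<open>\<open>W\<close> and \<open>b\<close> are quantified inside the eventuality: one
  threshold in \<open>n\<close> serves all scores in the ball and all minimisers, so no choice of
  threshold depends on the random outcome.\<close>

lemma local_obj_min_eventually:
  fixes C :: "real^'p^'p" and b0 :: "real^'p" and \<eta> \<alpha> :: "nat \<Rightarrow> real"
  assumes lim: "Cn \<longlonglongrightarrow> C" and sym: "\<And>n. transpose (Cn n) = Cn n"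
    and pd: "positive_definite C"
    and pos: "\<And>n. \<eta> n > 0" "\<And>n. \<alpha> n > 0"
    and eta1: "(\<lambda>n. \<eta> n / real n powr (3/4)) \<longlonglongrightarrow> 0"
    and eta2: "filterlim (\<lambda>n. \<eta> n / sqrt (real n)) at_top sequentially"
    and alpha: "(\<lambda>n. \<alpha> n / sqrt (real n)) \<longlonglongrightarrow> c3" "0 < c3"
    and "R \<ge> 0" "\<delta> > 0"
  defines "A \<equiv> {j. b0 $ j \<noteq> 0}"
  shows "\<forall>\<^sub>F n in sequentially. \<forall>W b. norm W \<le> R \<longrightarrow>
    (\<forall>b'. local_obj (Cn n) W n (\<eta> n) (\<alpha> n) b0 b \<le> local_obj (Cn n) W n (\<eta> n) (\<alpha> n) b0 b') \<longrightarrow>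
    {j. b $ j \<noteq> 0} = A \<and> norm (sqrt n *\<^sub>R (b - b0) - sub_inv_pad C A *v W) \<le> \<delta>"
proof -
  obtain l where l: "l > 0" "\<And>u. l * (norm u)\<^sup>2 \<le> u \<bullet> (C *v u)"
    using positive_definite_coercive[OF pd] by blast
  \<comment> \<open>The bound on \<open>norm u\<close> that the rate lemma gives with coercivity
    \<open>l / 2\<close> and penalty term \<open>d n < 1\<close>.\<close>
  define R' where "R' = (2 * R + 1) / (l / 2)"
  define K where "K = norm C + 1"
  define L where "L = sub_inv_pad C A"
  \<comment> \<open>The right-hand side of \<open>local_obj_min_nonzero_bound\<close> with
    \<open>R'\<close>, \<open>R\<close>, \<open>K\<close> and \<open>c3 + 1\<close> in place of
    \<open>norm u\<close>, \<open>norm W\<close>, \<open>norm (Cn n)\<close> and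
    \<open>\<alpha> n / sqrt n\<close>.\<close>
  define B where "B = (sqrt (1 + 2 * (c3 + 1) * R') + 1) * (R' * K + 2 * (K * R' + R))"
  define d where "d n = (\<Sum>j\<in>UNIV. if b0 $ j = 0 then 0 else 2 * (\<eta> n / (sqrt n * sqrt (1 + 2 * \<alpha> n * \<bar>b0 $ j\<bar>))))" for n
  \<comment> \<open>Stationarity errors with the estimate replaced by half the true coefficient, a
    lower bound for its absolute value once \<open>far\<close> holds.\<close>
  define \<nu> where "\<nu> n = (\<Sum>j\<in>UNIV. if b0 $ j = 0 then 0 else \<eta> n / (sqrt n * sqrt (1 + 2 * \<alpha> n * (\<bar>b0 $ j\<bar> / 2))))" for n
  have "R' \<ge> 0" using \<open>R \<ge> 0\<close> l by (simp add: R'_def)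
  have "K \<ge> 0" by (simp add: K_def)
  note vanish = penalty_slope_vanishes[OF eta1 alpha]
  have "d \<longlonglongrightarrow> (\<Sum>j\<in>(UNIV :: 'p set). 0)"
    unfolding d_def
  proof (rule tendsto_sum)
    fix j show "(\<lambda>n. if b0 $ j = 0 then 0 else 2 * (\<eta> n / (sqrt n * sqrt (1 + 2 * \<alpha> n * \<bar>b0 $ j\<bar>)))) \<longlonglongrightarrow> 0"
      using tendsto_mult_right_zero[OF vanish[of "\<bar>b0 $ j\<bar>"], of 2] by (cases "b0 $ j = 0") auto
  qed
  then have d: "\<forall>\<^sub>F n in sequentially. d n < 1" by (intro order_tendstoD(2)) auto
  have \<nu>: "\<nu> \<longlonglongrightarrow> (\<Sum>j\<in>(UNIV :: 'p set). 0)"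
    unfolding \<nu>_def
  proof (rule tendsto_sum)
    fix j show "(\<lambda>n. if b0 $ j = 0 then 0 else \<eta> n / (sqrt n * sqrt (1 + 2 * \<alpha> n * (\<bar>b0 $ j\<bar> / 2)))) \<longlonglongrightarrow> 0"
      using vanish[of "\<bar>b0 $ j\<bar> / 2"] by (cases "b0 $ j = 0") auto
  qed
  have "(\<lambda>n. CARD('p) * norm L * (CARD('p) * (norm (Cn n - C) * R' + \<nu> n))) \<longlonglongrightarrow>
      CARD('p) * norm L * (CARD('p) * (0 * R' + (\<Sum>j\<in>(UNIV :: 'p set). 0)))"
    using lim by (intro tendsto_intros \<nu> tendsto_norm_zero) (simp add: LIM_zero_iff)
  from order_tendstoD(2)[OF this, of \<delta>] \<open>\<delta> > 0\<close>
  have small: "\<forall>\<^sub>F n in sequentially. CARD('p) * norm L * (CARD('p) * (norm (Cn n - C) * R' + \<nu> n)) < \<delta>"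
    by simp
  have gram: "\<forall>\<^sub>F n in sequentially. norm (Cn n) < K"
    by (rule order_tendstoD(2)[OF tendsto_norm[OF lim]]) (simp add: K_def)
  have a: "\<forall>\<^sub>F n in sequentially. \<alpha> n / sqrt n < c3 + 1"
    by (rule order_tendstoD(2)[OF alpha(1)]) simp
  have e: "\<forall>\<^sub>F n in sequentially. \<eta> n / sqrt n > B / 2"
    using eta2 unfolding filterlim_at_top_dense by blast
  \<comment> \<open>A displacement of size \<open>R'\<close> on the scale of \<open>u\<close> then
    moves \<open>b $ j\<close> by less than half of a nonzero \<open>b0 $ j\<close>.\<close>
  have far: "\<forall>\<^sub>F n in sequentially. \<forall>j. b0 $ j \<noteq> 0 \<longrightarrow> R' < sqrt n * (\<bar>b0 $ j\<bar> / 2)"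
  proof (rule eventually_all_finite)
    fix j
    have "\<forall>\<^sub>F n in sequentially. R' / (\<bar>b0 $ j\<bar> / 2) < sqrt (real n)"
      using filterlim_compose[OF sqrt_at_top filterlim_real_sequentially] by (simp add: filterlim_at_top_dense)
    then show "\<forall>\<^sub>F n in sequentially. b0 $ j \<noteq> 0 \<longrightarrow> R' < sqrt n * (\<bar>b0 $ j\<bar> / 2)"
      by eventually_elim (auto simp: pos_divide_less_eq)
  qed
  from eventually_coercive[OF lim l] d small gram a e far eventually_gt_at_top[of 0]
  show ?thesis
  proof eventually_elim
    case (elim n)
    show ?case
    proof (intro allI impI)
      fix W b :: "real^'p"
      assume W: "norm W \<le> R"
      assume "\<forall>b'. local_obj (Cn n) W n (\<eta> n) (\<alpha> n) b0 b \<le> local_obj (Cn n) W n (\<eta> n) (\<alpha> n) b0 b'"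
      then have min: "\<And>b'. local_obj (Cn n) W n (\<eta> n) (\<alpha> n) b0 b \<le> local_obj (Cn n) W n (\<eta> n) (\<alpha> n) b0 b'"
        by blast
      define u where "u = sqrt n *\<^sub>R (b - b0)"
      have "n > 0" using elim by simp
      have "l / 2 * norm u \<le> 2 * norm W + d n"
        unfolding u_def d_def using elim(1) by (intro local_obj_min_rate[OF min \<open>n > 0\<close> pos]) blast
      then have "l / 2 * norm u \<le> 2 * R + 1" using W elim(2) by linarith
      then have u: "norm u \<le> R'" using l(1) by (simp add: R'_def field_simps)
      have out: "b $ j = 0" if "b0 $ j = 0" for j
      proof (rule ccontr)
        assume "b $ j \<noteq> 0"
        have "2 * (\<eta> n / sqrt n) \<le> (sqrt (1 + 2 * (\<alpha> n / sqrt n) * norm u) + 1)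
            * (norm u * norm (Cn n) + 2 * (norm (Cn n) * norm u + norm W))"
          unfolding u_def by (rule local_obj_min_nonzero_bound[OF sym min \<open>n > 0\<close> pos that]) fact
        also have "\<dots> \<le> B"
          unfolding B_def using u W elim(4,5) alpha(2) \<open>R' \<ge> 0\<close> \<open>K \<ge> 0\<close> \<open>R \<ge> 0\<close> pos[of n]
          by (intro mult_mono add_mono real_sqrt_le_mono order_refl) (auto intro!: add_nonneg_nonneg mult_nonneg_nonneg)
        finally show False using elim(6) by simp
      qed
      have inside: "\<bar>b $ j\<bar> \<ge> \<bar>b0 $ j\<bar> / 2 \<and> b $ j \<noteq> 0" if "b0 $ j \<noteq> 0" for j
      proof -
        have "sqrt n * \<bar>b $ j - b0 $ j\<bar> = \<bar>u $ j\<bar>" by (simp add: u_def abs_mult)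
        also have "\<dots> \<le> R'" using component_le_norm_cart[of u j] u by linarith
        also have "\<dots> < sqrt n * (\<bar>b0 $ j\<bar> / 2)" using elim(7) that by blast
        finally have "\<bar>b $ j - b0 $ j\<bar> < \<bar>b0 $ j\<bar> / 2" using \<open>n > 0\<close> by simp
        then show ?thesis using that by (auto simp: abs_if split: if_splits)
      qed
      have supp: "u $ j = 0" if "j \<notin> A" for j
        using that out[of j] by (simp add: A_def u_def)
      \<comment> \<open>The residual of the limiting equation on \<open>A\<close>. Coordinates
        outside \<open>A\<close> can be discarded because the padded inverse ignores them.\<close>
      define r where "r = restrict_vec A (C *v u - W)"
      have r: "\<bar>r $ j\<bar> \<le> norm (Cn n - C) * R' + \<nu> n" for j
      proof (cases "j \<in> A")
        case True
        then have j: "b0 $ j \<noteq> 0" by (simp add: A_def)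
        have "\<bar>(Cn n *v u) $ j - W $ j\<bar> \<le> \<eta> n / (sqrt n * sqrt (1 + 2 * \<alpha> n * \<bar>b $ j\<bar>))"
          unfolding u_def using inside[OF j] by (intro local_obj_min_stationary[OF sym min \<open>n > 0\<close> pos]) blast
        also have "\<dots> \<le> \<eta> n / (sqrt n * sqrt (1 + 2 * \<alpha> n * (\<bar>b0 $ j\<bar> / 2)))"
          using inside[OF j] pos[of n] \<open>n > 0\<close>
          by (intro divide_left_mono mult_left_mono real_sqrt_le_mono add_left_mono mult_pos_pos)
            (auto intro!: add_pos_nonneg)
        also have "\<dots> = (if b0 $ j = 0 then 0 else \<eta> n / (sqrt n * sqrt (1 + 2 * \<alpha> n * (\<bar>b0 $ j\<bar> / 2))))"
          using j by simp
        also have "\<dots> \<le> \<nu> n"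
          unfolding \<nu>_def using pos[of n]
          by (intro member_le_sum[of j UNIV "\<lambda>j. if b0 $ j = 0 then 0 else \<eta> n / (sqrt n * sqrt (1 + 2 * \<alpha> n * (\<bar>b0 $ j\<bar> / 2)))"])
            (auto intro!: divide_nonneg_nonneg)
        finally have 1: "\<bar>(Cn n *v u) $ j - W $ j\<bar> \<le> \<nu> n" .
        have "\<bar>((Cn n - C) *v u) $ j\<bar> \<le> norm (Cn n - C) * norm u"
          by (rule norm_matrix_vector_component_le)
        also have "\<dots> \<le> norm (Cn n - C) * R'" using u by (intro mult_left_mono) auto
        finally have "\<bar>(Cn n *v u) $ j - (C *v u) $ j\<bar> \<le> norm (Cn n - C) * R'"
          by (simp add: matrix_vector_mult_diff_rdistrib)
        with 1 True show ?thesis by (simp add: r_def restrict_vec_def)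
      next
        case False
        have "\<nu> n \<ge> 0" unfolding \<nu>_def using pos[of n] by (intro sum_nonneg) (auto intro!: divide_nonneg_nonneg)
        with False \<open>R' \<ge> 0\<close> show ?thesis by (simp add: r_def restrict_vec_def)
      qed
      have "norm r \<le> (\<Sum>j\<in>UNIV. \<bar>r $ j\<bar>)" by (rule norm_le_l1_cart)
      also have "\<dots> \<le> (\<Sum>j\<in>(UNIV :: 'p set). norm (Cn n - C) * R' + \<nu> n)"
        by (intro sum_mono r)
      finally have rn: "norm r \<le> CARD('p) * (norm (Cn n - C) * R' + \<nu> n)" by simp
      have "u - L *v W = L *v (C *v u) - L *v W"
        unfolding L_def by (subst sub_inv_pad_left_inverse[OF pd supp]) auto
      also have "\<dots> = L *v r"
        unfolding r_def L_def sub_inv_pad_restrict by (simp add: matrix_vector_mult_diff_distrib)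
      finally have "norm (u - L *v W) = norm (L *v r)" by simp
      also have "\<dots> \<le> CARD('p) * norm L * norm r" by (rule norm_matrix_vector_mult_le)
      also have "\<dots> \<le> CARD('p) * norm L * (CARD('p) * (norm (Cn n - C) * R' + \<nu> n))"
        by (intro mult_left_mono rn) simp
      also have "\<dots> < \<delta>" using elim(3) .
      finally have "norm (u - L *v W) \<le> \<delta>" by simp
      moreover have "{j. b $ j \<noteq> 0} = A"
        using out inside by (auto simp: A_def)
      ultimately show "{j. b $ j \<noteq> 0} = A \<and> norm (sqrt n *\<^sub>R (b - b0) - sub_inv_pad C A *v W) \<le> \<delta>"
        by (simp add: u_def L_def)
    qed
  qed
qed

section \<open>Tightness and asymptotic normality of the score\<close>

lemma cmod_cis_diff_le: "cmod (cis a - cis b) \<le> \<bar>a - b\<bar>"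
proof -
  have "cis a - cis b = cis b * (cis (a - b) - 1)" by (simp add: cis_mult right_diff_distrib)
  then have "cmod (cis a - cis b) = cmod (cis (a - b) - 1)" by (simp add: norm_mult)
  also have "\<dots> \<le> \<bar>a - b\<bar>"
    using iexp_approx1[of "a - b" 0] by (simp add: cis_conv_exp)
  finally show ?thesis .
qed

text \<open>Closeness is known only while a third variable \<open>V\<close> stays bounded. There
  \<open>cis\<close> is 1-Lipschitz; elsewhere two points of the unit circle differ by at most
  2.\<close>

lemma (in prob_space) cf_diff_le:
  fixes Z Y :: "'a \<Rightarrow> 'b::euclidean_space" and V :: "'a \<Rightarrow> 'c::euclidean_space"
  assumes [measurable]: "Z \<in> borel_measurable M" "Y \<in> borel_measurable M" "V \<in> borel_measurable M"
    and close: "\<And>\<omega>. \<omega> \<in> space M \<Longrightarrow> norm (V \<omega>) \<le> R \<Longrightarrow> norm (Z \<omega> - Y \<omega>) \<le> \<delta>" and "\<delta> \<ge> 0"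
  shows "cmod ((\<integral>\<omega>. cis (t \<bullet> Z \<omega>) \<partial>M) - (\<integral>\<omega>. cis (t \<bullet> Y \<omega>) \<partial>M))
    \<le> norm t * \<delta> + 2 * prob {\<omega> \<in> space M. norm (V \<omega>) > R}"
proof -
  let ?E = "{\<omega> \<in> space M. norm (V \<omega>) > R}"
  have "cmod ((\<integral>\<omega>. cis (t \<bullet> Z \<omega>) \<partial>M) - (\<integral>\<omega>. cis (t \<bullet> Y \<omega>) \<partial>M)) = cmod (\<integral>\<omega>. cis (t \<bullet> Z \<omega>) - cis (t \<bullet> Y \<omega>) \<partial>M)"
    by (simp add: integrable_cis)
  also have "\<dots> \<le> (\<integral>\<omega>. cmod (cis (t \<bullet> Z \<omega>) - cis (t \<bullet> Y \<omega>)) \<partial>M)"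
    by (rule integral_norm_bound)
  also have "\<dots> \<le> (\<integral>\<omega>. norm t * \<delta> + 2 * indicator ?E \<omega> \<partial>M)"
  proof (rule integral_mono)
    fix \<omega> assume \<omega>: "\<omega> \<in> space M"
    show "cmod (cis (t \<bullet> Z \<omega>) - cis (t \<bullet> Y \<omega>)) \<le> norm t * \<delta> + 2 * indicator ?E \<omega>"
    proof (cases "norm (V \<omega>) \<le> R")
      case True
      have "cmod (cis (t \<bullet> Z \<omega>) - cis (t \<bullet> Y \<omega>)) \<le> \<bar>t \<bullet> (Z \<omega> - Y \<omega>)\<bar>"
        using cmod_cis_diff_le[of "t \<bullet> Z \<omega>" "t \<bullet> Y \<omega>"] by (simp add: inner_diff_right)
      also have "\<dots> \<le> norm t * norm (Z \<omega> - Y \<omega>)" by (rule Cauchy_Schwarz_ineq2)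
      also have "\<dots> \<le> norm t * \<delta>" using close[OF \<omega> True] by (intro mult_left_mono) auto
      finally show ?thesis using True by simp
    next
      case False
      have "cmod (cis (t \<bullet> Z \<omega>) - cis (t \<bullet> Y \<omega>)) \<le> 1 + 1"
        by (rule order_trans[OF norm_triangle_ineq4]) simp
      moreover have "0 \<le> norm t * \<delta>" using \<open>\<delta> \<ge> 0\<close> by simp
      ultimately show ?thesis using False \<omega> by simp
    qed
  qed (auto intro!: integrable_real_indicator integrable_norm Bochner_Integration.integrable_diff integrable_cis
      simp: emeasure_eq_measure)
  also have "\<dots> = norm t * \<delta> + 2 * prob ?E"
    by (subst Bochner_Integration.integral_add)
      (auto intro!: integrable_real_indicator simp: emeasure_eq_measure prob_space)
  finally show ?thesis .
qed

text \<open>A Slutsky-type statement: being uniformly close on the bounded events of a tight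
  \<open>V\<close> carries both the limiting characteristic function and tightness from
  \<open>Y\<close> to \<open>Z\<close>.\<close>

lemma conv_in_distribution_if_close:
  fixes Z Y :: "nat \<Rightarrow> 'a \<Rightarrow> 'b::euclidean_space" and V :: "nat \<Rightarrow> 'a \<Rightarrow> 'c::euclidean_space"
  assumes "prob_space M" "prob_space G" "sets G = sets borel"
    and Z: "\<And>n. Z n \<in> borel_measurable M" and Y: "\<And>n. Y n \<in> borel_measurable M"
    and V: "\<And>n. V n \<in> borel_measurable M"
    and cf: "\<And>t. (\<lambda>n. \<integral>\<omega>. cis (t \<bullet> Y n \<omega>) \<partial>M) \<longlonglongrightarrow> (\<integral>z. cis (t \<bullet> z) \<partial>G)"
    and tight: "\<And>e. e > 0 \<Longrightarrow> \<exists>R\<ge>0. \<forall>\<^sub>F n in sequentially. measure M {\<omega> \<in> space M. norm (V n \<omega>) > R} \<le> e"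
    and dom: "\<And>n \<omega>. norm (Y n \<omega>) \<le> K * norm (V n \<omega>)" and "K \<ge> 0"
    and close: "\<And>R \<delta>. R \<ge> 0 \<Longrightarrow> \<delta> > 0 \<Longrightarrow>
      \<forall>\<^sub>F n in sequentially. \<forall>\<omega>\<in>space M. norm (V n \<omega>) \<le> R \<longrightarrow> norm (Z n \<omega> - Y n \<omega>) \<le> \<delta>"
  shows "conv_in_distribution M Z G"
proof (rule levy_continuity_tight[OF assms(1-4)])
  interpret prob_space M by fact
  note [measurable] = Z Y V
  fix t :: 'b
  have "(\<lambda>n. (\<integral>\<omega>. cis (t \<bullet> Z n \<omega>) \<partial>M) - (\<integral>\<omega>. cis (t \<bullet> Y n \<omega>) \<partial>M)) \<longlonglongrightarrow> 0"
  proof (rule tendstoI)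
    fix r :: real assume "r > 0"
    \<comment> \<open>The summand 1 in the denominator covers \<open>t = 0\<close>.\<close>
    define \<delta> where "\<delta> = (r / 2) / (norm t + 1)"
    have tp: "norm t + 1 > 0" by (simp add: add_nonneg_pos)
    then have "\<delta> > 0" using \<open>r > 0\<close> by (simp add: \<delta>_def)
    have "norm t * \<delta> < (norm t + 1) * \<delta>" using \<open>\<delta> > 0\<close> by simp
    also have "\<dots> = r / 2"
      using nonzero_mult_div_cancel_left[of "norm t + 1" "r / 2"] tp
      by (simp only: \<delta>_def times_divide_eq_right)
    finally have t\<delta>: "norm t * \<delta> < r / 2" .
    obtain R where R: "R \<ge> 0" "\<forall>\<^sub>F n in sequentially. prob {\<omega> \<in> space M. norm (V n \<omega>) > R} \<le> r / 4"
      using tight[of "r / 4"] \<open>r > 0\<close> by auto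
    from R(2) close[OF R(1) \<open>\<delta> > 0\<close>]
    show "\<forall>\<^sub>F n in sequentially. dist ((\<integral>\<omega>. cis (t \<bullet> Z n \<omega>) \<partial>M) - (\<integral>\<omega>. cis (t \<bullet> Y n \<omega>) \<partial>M)) 0 < r"
    proof eventually_elim
      case (elim n)
      have "cmod ((\<integral>\<omega>. cis (t \<bullet> Z n \<omega>) \<partial>M) - (\<integral>\<omega>. cis (t \<bullet> Y n \<omega>) \<partial>M))
          \<le> norm t * \<delta> + 2 * prob {\<omega> \<in> space M. norm (V n \<omega>) > R}"
        using elim(2) \<open>\<delta> > 0\<close> by (intro cf_diff_le Z Y V) auto
      then show ?case using elim(1) t\<delta> by simp
    qed
  qed
  from tendsto_add[OF this cf[of t]]
  show "(\<lambda>n. \<integral>\<omega>. cis (t \<bullet> Z n \<omega>) \<partial>M) \<longlonglongrightarrow> (\<integral>z. cis (t \<bullet> z) \<partial>G)" by simp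
next
  interpret prob_space M by fact
  note [measurable] = Z Y V
  fix e :: real assume "e > 0"
  obtain R where R: "R \<ge> 0" "\<forall>\<^sub>F n in sequentially. prob {\<omega> \<in> space M. norm (V n \<omega>) > R} \<le> e"
    using tight[OF \<open>e > 0\<close>] by blast
  \<comment> \<open>The radius \<open>K * R + 1\<close> below is the bound for \<open>Y n\<close>,
    enlarged by the distance 1 between \<open>Z n\<close> and \<open>Y n\<close>.\<close>
  from R(2) close[OF R(1) zero_less_one]
  have "\<forall>\<^sub>F n in sequentially. prob {\<omega> \<in> space M. norm (Z n \<omega>) > K * R + 1} \<le> e"
  proof eventually_elim
    case (elim n)
    have "{\<omega> \<in> space M. norm (Z n \<omega>) > K * R + 1} \<subseteq> {\<omega> \<in> space M. norm (V n \<omega>) > R}"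
    proof (rule subsetI, rule ccontr)
      fix \<omega> assume *: "\<omega> \<in> {\<omega> \<in> space M. norm (Z n \<omega>) > K * R + 1}" "\<omega> \<notin> {\<omega> \<in> space M. norm (V n \<omega>) > R}"
      then have v: "norm (V n \<omega>) \<le> R" and \<omega>: "\<omega> \<in> space M" by auto
      have "norm (Y n \<omega>) \<le> K * R" using dom[of n \<omega>] mult_left_mono[OF v \<open>K \<ge> 0\<close>] by linarith
      moreover have "norm (Z n \<omega> - Y n \<omega>) \<le> 1" using elim(2) \<omega> v by blast
      ultimately show False using * norm_triangle_sub[of "Z n \<omega>" "Y n \<omega>"] by simp
    qed
    then have "prob {\<omega> \<in> space M. norm (Z n \<omega>) > K * R + 1} \<le> prob {\<omega> \<in> space M. norm (V n \<omega>) > R}"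
      by (intro finite_measure_mono) auto
    with elim(1) show ?case by linarith
  qed
  then show "\<exists>R. \<forall>\<^sub>F n in sequentially. prob {\<omega> \<in> space M. norm (Z n \<omega>) > R} \<le> e" by blast
qed

section \<open>Moments and limiting characteristic function of the score\<close>

lemma (in prob_space) iid_product_expectation:
  fixes \<epsilon> :: "nat \<Rightarrow> 'a \<Rightarrow> real"
  assumes indep: "indep_vars (\<lambda>_. borel) \<epsilon> UNIV"
    and ident: "\<And>i. distr M borel (\<epsilon> i) = distr M borel (\<epsilon> 0)"
    and int: "integrable M (\<epsilon> 0)" "integrable M (\<lambda>\<omega>. (\<epsilon> 0 \<omega>)\<^sup>2)"
    and mean: "expectation (\<epsilon> 0) = 0" and var: "variance (\<epsilon> 0) = \<sigma>\<^sup>2"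
  shows "integrable M (\<lambda>\<omega>. \<epsilon> i \<omega> * \<epsilon> k \<omega>)"
    and "expectation (\<lambda>\<omega>. \<epsilon> i \<omega> * \<epsilon> k \<omega>) = (if i = k then \<sigma>\<^sup>2 else 0)"
proof -
  have rv[measurable]: "random_variable borel (\<epsilon> i)" for i
    using indep by (simp add: indep_vars_def)
  \<comment> \<open>Moment hypotheses are stated for \<open>\<epsilon> 0\<close> alone; equality of
    laws carries them to every index.\<close>
  have trans: "integrable M (\<lambda>\<omega>. f (\<epsilon> i \<omega>)) = integrable M (\<lambda>\<omega>. f (\<epsilon> 0 \<omega>))"
    "expectation (\<lambda>\<omega>. f (\<epsilon> i \<omega>)) = expectation (\<lambda>\<omega>. f (\<epsilon> 0 \<omega>))"
    if "f \<in> borel_measurable borel" for f :: "real \<Rightarrow> real" and i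
  proof -
    show "integrable M (\<lambda>\<omega>. f (\<epsilon> i \<omega>)) = integrable M (\<lambda>\<omega>. f (\<epsilon> 0 \<omega>))"
      using integrable_distr_eq[OF rv[of i] that] integrable_distr_eq[OF rv[of 0] that] ident[of i] by simp
    show "expectation (\<lambda>\<omega>. f (\<epsilon> i \<omega>)) = expectation (\<lambda>\<omega>. f (\<epsilon> 0 \<omega>))"
      using integral_distr[OF rv[of i] that] integral_distr[OF rv[of 0] that] ident[of i] by simp
  qed
  have "integrable M (\<lambda>\<omega>. \<epsilon> i \<omega> * \<epsilon> k \<omega>) \<and> expectation (\<lambda>\<omega>. \<epsilon> i \<omega> * \<epsilon> k \<omega>) = (if i = k then \<sigma>\<^sup>2 else 0)"
  proof (cases "i = k")
    case True
    then show ?thesis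
      using trans[of "\<lambda>y. y * y" i] int(2) var mean by (simp add: power2_eq_square)
  next
    case False
    have ik: "integrable M (\<epsilon> j)" "expectation (\<epsilon> j) = 0" for j
      using trans[of "\<lambda>y. y" j] int(1) mean by simp_all
    have "indep_vars (\<lambda>_. borel) \<epsilon> {i, k}" by (rule indep_vars_subset[OF indep]) simp
    from indep_vars_integrable[OF _ this] indep_vars_lebesgue_integral[OF _ this] ik
    show ?thesis using False by simp
  qed
  then show "integrable M (\<lambda>\<omega>. \<epsilon> i \<omega> * \<epsilon> k \<omega>)"
    and "expectation (\<lambda>\<omega>. \<epsilon> i \<omega> * \<epsilon> k \<omega>) = (if i = k then \<sigma>\<^sup>2 else 0)" by auto
qed

text \<open>Off-diagonal products of the noise have mean zero, so only the trace of the Gram matrix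
  survives. Its convergence makes the score tight.\<close>

lemma (in prob_space) score_second_moment:
  fixes \<epsilon> :: "nat \<Rightarrow> 'a \<Rightarrow> real" and x :: "nat \<Rightarrow> real^'p"
  assumes "indep_vars (\<lambda>_. borel) \<epsilon> UNIV"
    and "\<And>i. distr M borel (\<epsilon> i) = distr M borel (\<epsilon> 0)"
    and "integrable M (\<epsilon> 0)" "integrable M (\<lambda>\<omega>. (\<epsilon> 0 \<omega>)\<^sup>2)"
    and "expectation (\<epsilon> 0) = 0" and "variance (\<epsilon> 0) = \<sigma>\<^sup>2"
  shows "integrable M (\<lambda>\<omega>. (norm (score x (\<lambda>i. \<epsilon> i \<omega>) n))\<^sup>2)"
    and "expectation (\<lambda>\<omega>. (norm (score x (\<lambda>i. \<epsilon> i \<omega>) n))\<^sup>2) = \<sigma>\<^sup>2 * (\<Sum>j\<in>UNIV. scaled_gram x n $ j $ j)"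
proof -
  note mom = iid_product_expectation[OF assms]
  have eq: "(norm (score x (\<lambda>i. \<epsilon> i \<omega>) n))\<^sup>2
      = (\<Sum>i<n. \<Sum>k<n. (x i \<bullet> x k / n) * (\<epsilon> i \<omega> * \<epsilon> k \<omega>))" for \<omega>
  proof -
    have "(norm (score x (\<lambda>i. \<epsilon> i \<omega>) n))\<^sup>2 = ((\<Sum>i<n. \<epsilon> i \<omega> *\<^sub>R x i) \<bullet> (\<Sum>k<n. \<epsilon> k \<omega> *\<^sub>R x k)) / n"
      unfolding score_def power2_norm_eq_inner by (simp add: inner_commute)
    also have "\<dots> = (\<Sum>i<n. \<Sum>k<n. (x i \<bullet> x k / n) * (\<epsilon> i \<omega> * \<epsilon> k \<omega>))"
      unfolding inner_sum_left inner_sum_right sum_divide_distrib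
      by (intro sum.cong refl) (simp add: inner_commute)
    finally show ?thesis .
  qed
  show "integrable M (\<lambda>\<omega>. (norm (score x (\<lambda>i. \<epsilon> i \<omega>) n))\<^sup>2)"
    unfolding eq by (intro Bochner_Integration.integrable_sum integrable_mult_right mom)
  have "expectation (\<lambda>\<omega>. (norm (score x (\<lambda>i. \<epsilon> i \<omega>) n))\<^sup>2)
      = (\<Sum>i<n. \<Sum>k<n. (x i \<bullet> x k / n) * (if i = k then \<sigma>\<^sup>2 else 0))"
    unfolding eq by (simp add: mom Bochner_Integration.integral_sum)
  also have "\<dots> = (\<Sum>i<n. (x i \<bullet> x i / n) * \<sigma>\<^sup>2)"
    by (simp add: if_distrib[where f = "\<lambda>z. _ * z"] cong: if_cong)
  also have "\<dots> = \<sigma>\<^sup>2 * ((\<Sum>i<n. \<Sum>j\<in>UNIV. x i $ j * x i $ j) / n)"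
    by (simp add: inner_vec_def sum_divide_distrib sum_distrib_left mult.commute)
  also have "(\<Sum>i<n. \<Sum>j\<in>UNIV. x i $ j * x i $ j) / n = (\<Sum>j\<in>UNIV. scaled_gram x n $ j $ j)"
    by (subst sum.swap) (simp add: scaled_gram_def sum_divide_distrib)
  finally show "expectation (\<lambda>\<omega>. (norm (score x (\<lambda>i. \<epsilon> i \<omega>) n))\<^sup>2) = \<sigma>\<^sup>2 * (\<Sum>j\<in>UNIV. scaled_gram x n $ j $ j)" .
qed

lemma (in prob_space) tight_if_second_moment_converges:
  fixes V :: "nat \<Rightarrow> 'a \<Rightarrow> 'b::euclidean_space"
  assumes V[measurable]: "\<And>n. V n \<in> borel_measurable M"
    and int: "\<And>n. integrable M (\<lambda>\<omega>. (norm (V n \<omega>))\<^sup>2)"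
    and lim: "(\<lambda>n. expectation (\<lambda>\<omega>. (norm (V n \<omega>))\<^sup>2)) \<longlonglongrightarrow> v" and "e > 0"
  shows "\<exists>R\<ge>0. \<forall>\<^sub>F n in sequentially. prob {\<omega> \<in> space M. norm (V n \<omega>) > R} \<le> e"
proof -
  \<comment> \<open>Chebyshev's inequality with a radius for which \<open>R\<^sup>2 * e\<close> is
    \<open>\<bar>v\<bar> + 1\<close>, an eventual bound on the second moments.\<close>
  define R where "R = sqrt ((\<bar>v\<bar> + 1) / e)"
  have "\<bar>v\<bar> + 1 > 0" by linarith
  then have "R > 0" using \<open>e > 0\<close> by (simp add: R_def)
  have R2: "R\<^sup>2 * e = \<bar>v\<bar> + 1" using \<open>e > 0\<close> by (simp add: R_def)
  have "\<forall>\<^sub>F n in sequentially. expectation (\<lambda>\<omega>. (norm (V n \<omega>))\<^sup>2) < \<bar>v\<bar> + 1"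
    by (rule order_tendstoD(2)[OF lim]) simp
  then have "\<forall>\<^sub>F n in sequentially. prob {\<omega> \<in> space M. norm (V n \<omega>) > R} \<le> e"
  proof eventually_elim
    case (elim n)
    let ?E = "{\<omega> \<in> space M. norm (V n \<omega>) > R}"
    have "R\<^sup>2 * prob ?E = expectation (\<lambda>\<omega>. R\<^sup>2 * indicator ?E \<omega>)" by simp
    also have "\<dots> \<le> expectation (\<lambda>\<omega>. (norm (V n \<omega>))\<^sup>2)"
    proof (rule integral_mono)
      show "R\<^sup>2 * indicator ?E \<omega> \<le> (norm (V n \<omega>))\<^sup>2" for \<omega>
        using \<open>R > 0\<close> by (auto simp: indicator_def intro!: power_mono)
    qed (auto intro!: integrable_real_indicator int simp: emeasure_eq_measure)
    also have "\<dots> \<le> R\<^sup>2 * e" using elim R2 by simp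
    finally show ?case using \<open>R > 0\<close> by simp
  qed
  with \<open>R > 0\<close> show ?thesis by (intro exI[of _ R]) auto
qed

text \<open>For fixed \<open>t\<close> the score becomes a scalar sum with weights
  \<open>x i \<bullet> t / sqrt n\<close>. Their squares add up to the Gram form at
  \<open>t\<close>, which converges; as this form is a mean of nonnegative terms, its convergence
  also makes the weights uniformly negligible.\<close>

lemma (in prob_space) score_cf_tendsto:
  fixes \<epsilon> :: "nat \<Rightarrow> 'a \<Rightarrow> real" and x :: "nat \<Rightarrow> real^'p"
  assumes iid: "indep_vars (\<lambda>_. borel) \<epsilon> UNIV"
     "\<And>i. distr M borel (\<epsilon> i) = distr M borel (\<epsilon> 0)"
     "integrable M (\<epsilon> 0)" "integrable M (\<lambda>\<omega>. (\<epsilon> 0 \<omega>)\<^sup>2)"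
     "expectation (\<epsilon> 0) = 0" "variance (\<epsilon> 0) = \<sigma>\<^sup>2"
    and design: "scaled_gram x \<longlonglongrightarrow> C"
  shows "(\<lambda>n. \<integral>\<omega>. cis (t \<bullet> score x (\<lambda>i. \<epsilon> i \<omega>) n) \<partial>M)
    \<longlonglongrightarrow> complex_of_real (exp (- (t \<bullet> ((\<sigma>\<^sup>2 *\<^sub>R C) *v t)) / 2))"
proof -
  have "(\<lambda>n. t \<bullet> (scaled_gram x n *v t)) \<longlonglongrightarrow> t \<bullet> (C *v t)"
    unfolding matrix_vector_mult_def
    by (intro tendsto_inner tendsto_const tendsto_vec_lambda tendsto_sum tendsto_mult tendsto_vec_nth design)
  then have quad: "(\<lambda>n. (\<Sum>i<n. (x i \<bullet> t)\<^sup>2) / real n) \<longlonglongrightarrow> t \<bullet> (C *v t)"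
    by (simp add: scaled_gram_quadratic)
  have "(\<lambda>n. \<integral>\<omega>. cis (\<Sum>i<n. (x i \<bullet> t / sqrt n) * \<epsilon> i \<omega>) \<partial>M)
      \<longlonglongrightarrow> complex_of_real (exp (- (\<sigma>\<^sup>2 * (t \<bullet> (C *v t)) / 2)))"
  proof (rule clt_weighted_sum_char[OF iid])
    show "(\<lambda>n. \<Sum>i<n. (x i \<bullet> t / sqrt (real n))\<^sup>2) \<longlonglongrightarrow> t \<bullet> (C *v t)"
      using quad by (simp add: power_divide sum_divide_distrib)
    fix \<delta> :: real assume "\<delta> > 0"
    then have "\<forall>\<^sub>F n in sequentially. \<forall>i<n. (x i \<bullet> t)\<^sup>2 < \<delta>\<^sup>2 * real n"
      by (intro convergent_mean_negligible[OF _ quad]) auto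
    then show "\<forall>\<^sub>F n in sequentially. \<forall>i<n. \<bar>x i \<bullet> t / sqrt (real n)\<bar> < \<delta>"
    proof eventually_elim
      case (elim n)
      show ?case
      proof (intro allI impI)
        fix i assume i: "i < n"
        then have "(x i \<bullet> t / sqrt n)\<^sup>2 < \<delta>\<^sup>2" using elim by (simp add: power_divide pos_divide_less_eq)
        then show "\<bar>x i \<bullet> t / sqrt n\<bar> < \<delta>"
          using \<open>\<delta> > 0\<close> by (metis abs_of_pos power2_less_imp_less power2_abs less_imp_le)
      qed
    qed
  qed
  moreover have "t \<bullet> score x (\<lambda>i. \<epsilon> i \<omega>) n = (\<Sum>i<n. (x i \<bullet> t / sqrt n) * \<epsilon> i \<omega>)" for \<omega> n
    by (simp add: score_def inner_sum_right inner_commute sum_divide_distrib mult.commute)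
  moreover have "t \<bullet> ((\<sigma>\<^sup>2 *\<^sub>R C) *v t) = \<sigma>\<^sup>2 * (t \<bullet> (C *v t))"
    by (simp add: scaleR_matrix_vector_assoc[symmetric])
  ultimately show ?thesis by simp
qed

section \<open>Selection consistency and asymptotic normality of the penalised estimator\<close>

theorem theorem4:
  fixes M :: "'a measure"
    and x :: "nat \<Rightarrow> real^'p"
    and bstar :: "real^'p"
    and \<epsilon> :: "nat \<Rightarrow> 'a \<Rightarrow> real"
    and \<sigma> :: real
    and C :: "real^'p^'p"
    and \<eta> \<alpha> :: "nat \<Rightarrow> real"
    and c3 :: real
    and btilde :: "nat \<Rightarrow> 'a \<Rightarrow> real^'p"
  assumes "prob_space M"
    and indep: "prob_space.indep_vars M (\<lambda>_. borel) \<epsilon> UNIV"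
    and ident: "\<And>i. distr M borel (\<epsilon> i) = distr M borel (\<epsilon> 0)"
    and int: "integrable M (\<epsilon> 0)" "integrable M (\<lambda>\<omega>. (\<epsilon> 0 \<omega>)^2)"
    and mean: "prob_space.expectation M (\<epsilon> 0) = 0"
    and var: "prob_space.variance M (\<epsilon> 0) = \<sigma>^2"
    and design: "(\<lambda>n. (1 / real n) *\<^sub>R (\<Sum>i<n. (\<chi> j k. x i $ j * x i $ k))) \<longlonglongrightarrow> C"
    and posdef: "positive_definite C"
    and pos: "\<And>n. \<eta> n > 0" "\<And>n. \<alpha> n > 0"
    and eta1: "(\<lambda>n. \<eta> n / real n powr (3/4)) \<longlonglongrightarrow> 0"
    and eta2: "filterlim (\<lambda>n. \<eta> n / sqrt (real n)) at_top sequentially"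
    and alpha: "(\<lambda>n. \<alpha> n / sqrt (real n)) \<longlonglongrightarrow> c3" "0 < c3"
    and meas: "\<And>n. btilde n \<in> borel_measurable M"
    and argmin: "\<And>n \<omega> b. \<omega> \<in> space M \<Longrightarrow>
        penalized_obj x (\<lambda>i. x i \<bullet> bstar + \<epsilon> i \<omega>) n (\<eta> n) (\<alpha> n) (btilde n \<omega>)
        \<le> penalized_obj x (\<lambda>i. x i \<bullet> bstar + \<epsilon> i \<omega>) n (\<eta> n) (\<alpha> n) b"
  shows "((\<lambda>n. measure M {\<omega> \<in> space M. {j. btilde n \<omega> $ j \<noteq> 0} = {j. bstar $ j \<noteq> 0}})
           \<longlonglongrightarrow> 1) \<and>
         (\<exists>G. centered_gaussian G (\<sigma>^2 *\<^sub>R sub_inv_pad C {j. bstar $ j \<noteq> 0}) \<and>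
           conv_in_distribution M
             (\<lambda>n \<omega>. sqrt (real n) *\<^sub>R (restrict_vec {j. bstar $ j \<noteq> 0} (btilde n \<omega>)
                                      - restrict_vec {j. bstar $ j \<noteq> 0} bstar)) G)"
proof -
  interpret prob_space M by fact
  define A where "A = {j. bstar $ j \<noteq> 0}"
  define L where "L = sub_inv_pad C A"
  define W where "W n \<omega> = score x (\<lambda>i. \<epsilon> i \<omega>) n" for n \<omega>
  define Z where "Z n \<omega> = sqrt (real n) *\<^sub>R (restrict_vec A (btilde n \<omega>) - restrict_vec A bstar)" for n \<omega>
  have gram: "scaled_gram x \<longlonglongrightarrow> C" using design by (simp add: scaled_gram_def[abs_def])
  have rv[measurable]: "random_variable borel (\<epsilon> i)" for i
    using indep by (simp add: indep_vars_def)
  note [measurable] = meas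
  have W[measurable]: "W n \<in> borel_measurable M" for n
    unfolding W_def score_def by measurable
  have Lm[measurable]: "(\<lambda>v. L *v v) \<in> borel_measurable borel"
    by (intro borel_measurable_continuous_onI linear_continuous_on_compose[OF continuous_on_id]) simp
  have Rm: "(\<lambda>v :: real^'p. restrict_vec A v) \<in> borel_measurable borel"
  proof -
    have "continuous_on UNIV (\<lambda>v :: real^'p. if j \<in> A then v $ j else 0)" for j
      by (cases "j \<in> A") (auto intro!: continuous_intros)
    then show ?thesis
      unfolding restrict_vec_def
      by (intro borel_measurable_continuous_onI continuous_on_vec_lambda)
  qed
  have Z: "Z n \<in> borel_measurable M" for n
    unfolding Z_def using measurable_compose[OF meas Rm] by measurable
  note moments = score_second_moment[OF indep ident int mean var, of x]
  have "(\<lambda>n. \<sigma>\<^sup>2 * (\<Sum>j\<in>UNIV. scaled_gram x n $ j $ j)) \<longlonglongrightarrow> \<sigma>\<^sup>2 * (\<Sum>j\<in>UNIV. C $ j $ j)"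
    by (intro tendsto_intros gram)
  then have lim: "(\<lambda>n. expectation (\<lambda>\<omega>. (norm (W n \<omega>))\<^sup>2)) \<longlonglongrightarrow> \<sigma>\<^sup>2 * (\<Sum>j\<in>UNIV. C $ j $ j)"
    by (simp add: W_def moments(2))
  have tight: "\<exists>R\<ge>0. \<forall>\<^sub>F n in sequentially. prob {\<omega> \<in> space M. norm (W n \<omega>) > R} \<le> e" if "e > 0" for e
    by (rule tight_if_second_moment_converges[OF W _ lim that]) (simp add: W_def moments(1))
  \<comment> \<open>The deterministic result applied outcome by outcome; its uniformity in the score
    and the minimiser makes the threshold independent of \<open>\<omega>\<close>.\<close>
  have selected: "\<forall>\<^sub>F n in sequentially. \<forall>\<omega>\<in>space M. norm (W n \<omega>) \<le> R \<longrightarrow>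
      {j. btilde n \<omega> $ j \<noteq> 0} = A \<and> norm (Z n \<omega> - L *v W n \<omega>) \<le> \<delta>" if "R \<ge> 0" "\<delta> > 0" for R \<delta>
    using local_obj_min_eventually[OF gram scaled_gram_symmetric posdef pos eta1 eta2 alpha that, of bstar]
      eventually_gt_at_top[of 0]
  proof eventually_elim
    case (elim n)
    show ?case
    proof (intro ballI impI)
      fix \<omega> assume \<omega>: "\<omega> \<in> space M" and small: "norm (W n \<omega>) \<le> R"
      have "local_obj (scaled_gram x n) (W n \<omega>) n (\<eta> n) (\<alpha> n) bstar (btilde n \<omega>)
          \<le> local_obj (scaled_gram x n) (W n \<omega>) n (\<eta> n) (\<alpha> n) bstar b'" for b'
        using argmin[OF \<omega>, of n b']
        unfolding penalized_obj_eq_local_obj[OF elim(2), where e = "\<lambda>i. \<epsilon> i \<omega>"] by (simp add: W_def)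
      with elim(1) small
      have *: "{j. btilde n \<omega> $ j \<noteq> 0} = A"
        "norm (sqrt n *\<^sub>R (btilde n \<omega> - bstar) - L *v W n \<omega>) \<le> \<delta>"
        unfolding A_def L_def by blast+
      \<comment> \<open>With the correct support, restriction changes neither vector, so
        \<open>Z\<close> is the full rescaled error.\<close>
      have "restrict_vec A (btilde n \<omega>) = btilde n \<omega>" "restrict_vec A bstar = bstar"
        using *(1) by (auto simp: restrict_vec_def vec_eq_iff A_def)
      with * show "{j. btilde n \<omega> $ j \<noteq> 0} = A \<and> norm (Z n \<omega> - L *v W n \<omega>) \<le> \<delta>"
        by (simp add: Z_def)
    qed
  qed
  have "(\<lambda>n. prob {\<omega> \<in> space M. {j. btilde n \<omega> $ j \<noteq> 0} = A}) \<longlonglongrightarrow> 1"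
  proof (rule tendstoI)
    fix e :: real assume "e > 0"
    then obtain R where R: "R \<ge> 0" "\<forall>\<^sub>F n in sequentially. prob {\<omega> \<in> space M. norm (W n \<omega>) > R} \<le> e / 2"
      using tight[of "e / 2"] by auto
    from R(2) selected[OF R(1) zero_less_one]
    show "\<forall>\<^sub>F n in sequentially. dist (prob {\<omega> \<in> space M. {j. btilde n \<omega> $ j \<noteq> 0} = A}) 1 < e"
    proof eventually_elim
      case (elim n)
      \<comment> \<open>Equality of supports becomes a finite conjunction over coordinates, which
        makes measurability evident.\<close>
      have eq: "{\<omega> \<in> space M. {j. btilde n \<omega> $ j \<noteq> 0} = A}
          = {\<omega> \<in> space M. \<forall>j\<in>UNIV. (btilde n \<omega> $ j \<noteq> 0) = (j \<in> A)}" by auto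
      have S: "{\<omega> \<in> space M. {j. btilde n \<omega> $ j \<noteq> 0} = A} \<in> events"
        unfolding eq by measurable
      have "1 - prob {\<omega> \<in> space M. {j. btilde n \<omega> $ j \<noteq> 0} = A}
          = prob (space M - {\<omega> \<in> space M. {j. btilde n \<omega> $ j \<noteq> 0} = A})"
        using prob_compl[OF S] by simp
      also have "\<dots> \<le> prob {\<omega> \<in> space M. norm (W n \<omega>) > R}"
        using elim(2) by (intro finite_measure_mono) (auto simp: not_less[symmetric])
      finally show ?case using elim(1) \<open>e > 0\<close> prob_le_1[of "{\<omega> \<in> space M. {j. btilde n \<omega> $ j \<noteq> 0} = A}"]
        by (simp add: dist_real_def)
    qed
  qed
  moreover have "\<exists>G. centered_gaussian G (\<sigma>\<^sup>2 *\<^sub>R L) \<and> conv_in_distribution M Z G"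
  proof -
    have "0 \<le> v \<bullet> (C *v v)" for v
      using posdef unfolding positive_definite_def by (cases "v = 0") (auto intro: less_imp_le)
    then obtain G0 where G0: "centered_gaussian G0 (\<sigma>\<^sup>2 *\<^sub>R C)"
      using centered_gaussian_exists[of "\<sigma>\<^sup>2 *\<^sub>R C"] posdef
      by (auto simp: positive_definite_def transpose_scalar scaleR_matrix_vector_assoc[symmetric])
    then have G0p: "prob_space G0" and G0s: "sets G0 = sets borel"
      and G0cf: "\<And>t. (\<integral>z. cis (t \<bullet> z) \<partial>G0) = complex_of_real (exp (- (t \<bullet> ((\<sigma>\<^sup>2 *\<^sub>R C) *v t)) / 2))"
      by (auto simp: centered_gaussian_def)
    \<comment> \<open>The limit is the image of the limit law of the score under \<open>L\<close>.
      Its covariance is \<open>\<sigma>\<^sup>2\<close> times \<open>L C L^T\<close>, which the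
      sandwich identity reduces to \<open>\<sigma>\<^sup>2 *\<^sub>R L\<close>.\<close>
    define G where "G = distr G0 borel (\<lambda>v. L *v v)"
    have LG0: "(\<lambda>v. L *v v) \<in> borel_measurable G0"
      using Lm measurable_cong_sets[OF G0s refl] by blast
    have adj: "t \<bullet> (L *v v) = (transpose L *v t) \<bullet> v" for t v
      by (simp add: dot_lmul_matrix transpose_matrix_vector)
    have Gp: "prob_space G" unfolding G_def by (rule prob_space.prob_space_distr[OF G0p LG0])
    have Gcf: "(\<integral>z. cis (t \<bullet> z) \<partial>G) = (\<integral>z. cis ((transpose L *v t) \<bullet> z) \<partial>G0)" for t
    proof -
      have "(\<lambda>z. cis (t \<bullet> z)) \<in> borel_measurable borel"
        by (intro borel_measurable_continuous_onI continuous_intros)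
      then show ?thesis unfolding G_def by (simp add: integral_distr[OF LG0] adj)
    qed
    have "centered_gaussian G (\<sigma>\<^sup>2 *\<^sub>R L)"
      unfolding centered_gaussian_def Gcf G0cf
      using Gp sub_inv_pad_sandwich[OF posdef, of A]
      by (simp add: G_def L_def scaleR_matrix_vector_assoc[symmetric])
    moreover have "conv_in_distribution M Z G"
    proof (rule conv_in_distribution_if_close[where V = W and Y = "\<lambda>n \<omega>. L *v W n \<omega>"
          and K = "CARD('p) * norm L"])
      show "(\<lambda>\<omega>. L *v W n \<omega>) \<in> borel_measurable M" for n by measurable
      show "(\<lambda>n. \<integral>\<omega>. cis (t \<bullet> (L *v W n \<omega>)) \<partial>M) \<longlonglongrightarrow> (\<integral>z. cis (t \<bullet> z) \<partial>G)" for t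
        unfolding Gcf G0cf adj W_def by (rule score_cf_tendsto[OF indep ident int mean var gram])
      show "\<forall>\<^sub>F n in sequentially. \<forall>\<omega>\<in>space M. norm (W n \<omega>) \<le> R \<longrightarrow> norm (Z n \<omega> - L *v W n \<omega>) \<le> \<delta>"
        if "R \<ge> 0" "\<delta> > 0" for R \<delta>
        using selected[OF that] by eventually_elim blast
    qed (use Gp Z W tight in \<open>auto simp: G_def prob_space_axioms norm_matrix_vector_mult_le\<close>)
    ultimately show ?thesis by blast
  qed
  ultimately show ?thesis unfolding A_def L_def Z_def by simp
qed

end
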